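(* The following gives a complete list of the idempotent states on $SU_0(2)$. (1) The family $\phi_n$, $n\in\mathbb{N}\cup\{\infty\}$, where $\phi_1$ is the counit, $\phi_\infty$ is the idempotent state induced by the Haar state of the quantum subgroup $U(1)$, and $\phi_n$, $2\le n<\infty$, denotes the idempotent state induced by the Haar state on the quantum subgroup $\mathbb{Z}_n$. (2) The family $\psi_n$, $n\in\mathbb{Z}_+$, defined by $$\psi_n\big((\alpha^* )^r\gamma^k\alpha^s\big)=\begin{cases}1&\text{if }k=0,\ r=s\le n,\\0&\text{else}\end{cases}$$ for $r,s\in\mathbb{Z}_+$, $k\in\mathbb{Z}$, with the convention $\gamma^{-k}=(\gamma^* )^k$.
   Context: $\mathbb{Z}_+=\{0,1,2,\dots\}$, $\mathbb{N}=\{1,2,\dots\}$. $\mathrm{Pol}(SU_0(2))$ is the $*$-bialgebra generated by $\alpha,\gamma$ with relations $\alpha\gamma=\alpha\gamma^*=0$, $\gamma\gamma^*=\gamma^*\gamma$, $\alpha^*\alpha+\gamma^*\gamma=1$, $\alpha\alpha^*-\alpha^*\alpha=\gamma^*\gamma$ (so $\alpha\alpha^*=1$), coproduct $\Delta(\alpha)=\alpha\otimes\alpha$, $\Delta(\gamma)=\gamma\otimes\alpha+\alpha^*\otimes\gamma$, counit $\varepsilon(\alpha)=1$, $\varepsilon(\gamma)=0$. $C(SU_0(2))$ is its universal enveloping $C^*$-algebra with the extended coproduct and counit (a $C^*$-bialgebra). The elements $(\alpha^* )^r\gamma^k\alpha^s$ ($r,s\in\mathbb{Z}_+$, $k\in\mathbb{Z}$)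 span $\mathrm{Pol}(SU_0(2))$. A state $\phi$ on $C(SU_0(2))$ is idempotent if $(\phi\otimes\phi)\circ\Delta=\phi$. $U(1)$ is a quantum subgroup via the surjective coproduct-preserving unital $*$-homomorphism $j:C(SU_0(2))\to C(U(1))$, $\alpha\mapsto w$ (the coordinate function on $U(1)$), $\gamma\mapsto0$; $\mathbb{Z}_n\subset U(1)$ (the $n$-th roots of unity) is a quantum subgroup by composing $j$ with restriction to $\mathbb{Z}_n$. The idempotent state induced by the Haar state of such a subgroup $K$ is $x\mapsto\int_Kj(x)\,d\mu_K$, $\mu_K$ the normalized Haar measure of $K$. *)

theory Defs
  imports "HOL-Analysis.Analysis" "HOL-Library.Lub_Glb"
begin

section \<open>Unital complex star-algebras and C*-algebras\<close>

class star_algebra = ring_1 +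
  fixes scaleC :: "complex \<Rightarrow> 'a \<Rightarrow> 'a"  (infixr \<open>*\<^sub>C\<close> 75)
    and star :: "'a \<Rightarrow> 'a"
  assumes scaleC_add_right: "c *\<^sub>C (x + y) = c *\<^sub>C x + c *\<^sub>C y"
    and scaleC_add_left: "(c + d) *\<^sub>C x = c *\<^sub>C x + d *\<^sub>C x"
    and scaleC_scaleC: "c *\<^sub>C (d *\<^sub>C x) = (c * d) *\<^sub>C x"
    and scaleC_one: "1 *\<^sub>C x = x"
    and mult_scaleC_left: "(c *\<^sub>C x) * y = c *\<^sub>C (x * y)"
    and mult_scaleC_right: "x * (c *\<^sub>C y) = c *\<^sub>C (x * y)"
    and star_star: "star (star x) = x"
    and star_add: "star (x + y) = star x + star y"
    and star_mult: "star (x * y) = star y * star x"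
    and star_scaleC: "star (c *\<^sub>C x) = cnj c *\<^sub>C star x"

class cstar_algebra = star_algebra + real_normed_algebra_1 + banach +
  assumes scaleR_scaleC: "r *\<^sub>R x = complex_of_real r *\<^sub>C x"
    and norm_scaleC: "norm (c *\<^sub>C x) = cmod c * norm x"
    and cstar_identity: "norm (star x * x) = (norm x)\<^sup>2"

instantiation complex :: cstar_algebra
begin

definition scaleC_complex :: "complex \<Rightarrow> complex \<Rightarrow> complex"
  where "scaleC_complex c z = c * z"

definition star_complex :: "complex \<Rightarrow> complex"
  where "star_complex z = cnj z"

instance
proof
  fix z :: complex
  show "norm (star z * z) = (norm z)\<^sup>2"
    by (simp add: star_complex_def norm_mult power2_eq_square)
qed (auto simp: scaleC_complex_def star_complex_def algebra_simps scaleR_conv_of_real norm_mult)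

end

definition clinear :: "('a::star_algebra \<Rightarrow> 'b::star_algebra) \<Rightarrow> bool"
  where "clinear f \<longleftrightarrow> (\<forall>x y. f (x + y) = f x + f y) \<and> (\<forall>c x. f (c *\<^sub>C x) = c *\<^sub>C f x)"

definition star_hom :: "('a::star_algebra \<Rightarrow> 'b::star_algebra) \<Rightarrow> bool"
  where "star_hom f \<longleftrightarrow> clinear f \<and> f 1 = 1 \<and>
    (\<forall>x y. f (x * y) = f x * f y) \<and> (\<forall>x. f (star x) = star (f x))"

definition state :: "('a::cstar_algebra \<Rightarrow> complex) \<Rightarrow> bool"
  where "state \<phi> \<longleftrightarrow> clinear \<phi> \<and> continuous_on UNIV \<phi> \<and>
    (\<forall>x. \<phi> (star x * x) \<in> \<real>\<^sub>\<ge>\<^sub>0) \<and> \<phi> 1 = 1"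

definition cstar_seminorm :: "('a::star_algebra \<Rightarrow> real) \<Rightarrow> bool"
  where "cstar_seminorm p \<longleftrightarrow>
    (\<forall>x. 0 \<le> p x) \<and> (\<forall>x y. p (x + y) \<le> p x + p y) \<and> (\<forall>c x. p (c *\<^sub>C x) = cmod c * p x) \<and>
    (\<forall>x y. p (x * y) \<le> p x * p y) \<and> (\<forall>x. p (star x * x) = (p x)\<^sup>2)"

text \<open>
  The universal enveloping C*-algebra of a star-algebra is its Hausdorff completion in the
  largest C*-seminorm. Since the map into the C*-algebra is a star-homomorphism, the pulled-back
  norm is itself a C*-seminorm, so that the last clause says that it is the largest one.
\<close>

definition enveloping_cstar :: "('p::star_algebra \<Rightarrow> 'a::cstar_algebra) \<Rightarrow> bool"
  where "enveloping_cstar \<iota> \<longleftrightarrow> star_hom \<iota> \<and> closure (range \<iota>) = UNIV \<and>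
    (\<forall>p x. cstar_seminorm p \<longrightarrow> p x \<le> norm (\<iota> x))"


section \<open>The spatial tensor product of C*-algebras\<close>

text \<open>
  A list of pairs stands for the finite sum of the corresponding elementary tensors in the
  algebraic tensor product.
\<close>

definition ten_mult :: "('a::star_algebra \<times> 'b::star_algebra) list \<Rightarrow> ('a \<times> 'b) list \<Rightarrow> ('a \<times> 'b) list"
  where "ten_mult us vs = concat (map (\<lambda>(a, b). map (\<lambda>(c, d). (a * c, b * d)) vs) us)"

definition ten_star :: "('a::star_algebra \<times> 'b::star_algebra) list \<Rightarrow> ('a \<times> 'b) list"
  where "ten_star us = map (\<lambda>(a, b). (star a, star b)) us"

definition ten_functional ::
    "('a \<Rightarrow> complex) \<Rightarrow> ('b \<Rightarrow> complex) \<Rightarrow> ('a \<times> 'b) list \<Rightarrow> complex"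
  where "ten_functional \<phi> \<psi> us = (\<Sum>(a, b)\<leftarrow>us. \<phi> a * \<psi> b)"

text \<open>
  The least upper bound of this set is the spatial (minimal) norm of the tensor \<open>u\<close> given
  by \<open>us\<close>, i.e. the supremum, over all pairs of states with GNS representations \<open>\<pi>\<^sub>1\<close>, \<open>\<pi>\<^sub>2\<close>,
  of the operator norm of \<open>(\<pi>\<^sub>1 \<otimes> \<pi>\<^sub>2) u\<close> on the Hilbert space tensor product: the vectors
  represented by the algebraic tensors \<open>vs\<close> are dense in that space, the square of the
  norm of such a vector is the value of the product functional at \<open>v* v\<close>, and \<open>u\<close> maps it
  to the vector represented by \<open>u v\<close>.
\<close>

definition spatial_values :: "('a::cstar_algebra \<times> 'b::cstar_algebra) list \<Rightarrow> real set"
  where "spatial_values us =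
    {sqrt (Re (ten_functional \<phi> \<psi> (ten_mult (ten_star (ten_mult us vs)) (ten_mult us vs))))
      | \<phi> \<psi> vs. state \<phi> \<and> state \<psi> \<and> Re (ten_functional \<phi> \<psi> (ten_mult (ten_star vs) vs)) \<le> 1}"

text \<open>
  The map \<open>t\<close> sends \<open>(a, b)\<close> to the elementary tensor of \<open>a\<close> and \<open>b\<close>.
\<close>

definition spatial_tensor ::
    "('a::cstar_algebra \<Rightarrow> 'b::cstar_algebra \<Rightarrow> 'c::cstar_algebra) \<Rightarrow> bool"
  where "spatial_tensor t \<longleftrightarrow>
    (\<forall>a. clinear (t a)) \<and> (\<forall>b. clinear (\<lambda>a. t a b)) \<and> t 1 1 = 1 \<and>
    (\<forall>a b a' b'. t a b * t a' b' = t (a * a') (b * b')) \<and>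
    (\<forall>a b. star (t a b) = t (star a) (star b)) \<and>
    closure (range (\<lambda>us. \<Sum>(a, b)\<leftarrow>us. t a b)) = UNIV \<and>
    (\<forall>us. isLub UNIV (spatial_values us) (norm (\<Sum>(a, b)\<leftarrow>us. t a b)))"

definition tensor_functional ::
    "('a::cstar_algebra \<Rightarrow> 'b::cstar_algebra \<Rightarrow> 'c::cstar_algebra) \<Rightarrow>
      ('a \<Rightarrow> complex) \<Rightarrow> ('b \<Rightarrow> complex) \<Rightarrow> 'c \<Rightarrow> complex"
  where "tensor_functional t \<phi> \<psi> =
    (THE F. clinear F \<and> continuous_on UNIV F \<and> (\<forall>a b. F (t a b) = \<phi> a * \<psi> b))"

definition idempotent_state ::
    "('a::cstar_algebra \<Rightarrow> 'a \<Rightarrow> 'b::cstar_algebra) \<Rightarrow> ('a \<Rightarrow> 'b) \<Rightarrow> ('a \<Rightarrow> complex) \<Rightarrow> bool"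
  where "idempotent_state t \<Delta> \<phi> \<longleftrightarrow> state \<phi> \<and> tensor_functional t \<phi> \<phi> \<circ> \<Delta> = \<phi>"


section \<open>The star-algebra Pol(SU_0(2))\<close>

text \<open>
  The unital star-algebra presented by generators and relations: star-algebra terms modulo the
  least congruence that contains the star-algebra axioms and the defining relations.
\<close>

datatype pol_term =
    PZero | POne | PAlpha | PGamma
  | PAdd pol_term pol_term | PMul pol_term pol_term | PScale complex pol_term | PStar pol_term

inductive pol_eq :: "pol_term \<Rightarrow> pol_term \<Rightarrow> bool" where
  refl: "pol_eq x x"
| sym: "pol_eq x y \<Longrightarrow> pol_eq y x"
| trans: "pol_eq x y \<Longrightarrow> pol_eq y z \<Longrightarrow> pol_eq x z"
| cong_add: "pol_eq x x' \<Longrightarrow> pol_eq y y' \<Longrightarrow> pol_eq (PAdd x y) (PAdd x' y')"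
| cong_mul: "pol_eq x x' \<Longrightarrow> pol_eq y y' \<Longrightarrow> pol_eq (PMul x y) (PMul x' y')"
| cong_scale: "pol_eq x x' \<Longrightarrow> pol_eq (PScale c x) (PScale c x')"
| cong_star: "pol_eq x x' \<Longrightarrow> pol_eq (PStar x) (PStar x')"
| add_assoc: "pol_eq (PAdd (PAdd x y) z) (PAdd x (PAdd y z))"
| add_comm: "pol_eq (PAdd x y) (PAdd y x)"
| add_zero: "pol_eq (PAdd PZero x) x"
| add_inv: "pol_eq (PAdd (PScale (-1) x) x) PZero"
| mul_assoc: "pol_eq (PMul (PMul x y) z) (PMul x (PMul y z))"
| one_mul: "pol_eq (PMul POne x) x"
| mul_one: "pol_eq (PMul x POne) x"
| distrib_left: "pol_eq (PMul x (PAdd y z)) (PAdd (PMul x y) (PMul x z))"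
| distrib_right: "pol_eq (PMul (PAdd x y) z) (PAdd (PMul x z) (PMul y z))"
| scale_add_right: "pol_eq (PScale c (PAdd x y)) (PAdd (PScale c x) (PScale c y))"
| scale_add_left: "pol_eq (PScale (c + d) x) (PAdd (PScale c x) (PScale d x))"
| scale_scale: "pol_eq (PScale c (PScale d x)) (PScale (c * d) x)"
| scale_one: "pol_eq (PScale 1 x) x"
| scale_mul_left: "pol_eq (PMul (PScale c x) y) (PScale c (PMul x y))"
| scale_mul_right: "pol_eq (PMul x (PScale c y)) (PScale c (PMul x y))"
| star_star: "pol_eq (PStar (PStar x)) x"
| star_add: "pol_eq (PStar (PAdd x y)) (PAdd (PStar x) (PStar y))"
| star_mul: "pol_eq (PStar (PMul x y)) (PMul (PStar y) (PStar x))"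
| star_scale: "pol_eq (PStar (PScale c x)) (PScale (cnj c) (PStar x))"
| alpha_gamma: "pol_eq (PMul PAlpha PGamma) PZero"
| alpha_gamma_star: "pol_eq (PMul PAlpha (PStar PGamma)) PZero"
| gamma_normal: "pol_eq (PMul PGamma (PStar PGamma)) (PMul (PStar PGamma) PGamma)"
| unit_relation:
    "pol_eq (PAdd (PMul (PStar PAlpha) PAlpha) (PMul (PStar PGamma) PGamma)) POne"
| commutator_relation:
    "pol_eq (PAdd (PMul PAlpha (PStar PAlpha)) (PScale (-1) (PMul (PStar PAlpha) PAlpha)))
      (PMul (PStar PGamma) PGamma)"

quotient_type pol = pol_term / pol_eq
proof (rule equivpI)
  show "reflp pol_eq" by (rule reflpI) (rule pol_eq.refl)
  show "symp pol_eq" by (rule sympI) (rule pol_eq.sym)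
  show "transp pol_eq" by (rule transpI) (rule pol_eq.trans)
qed

text \<open>The counit on terms; used only to show that \<open>0 \<noteq> 1\<close> in the quotient.\<close>

primrec pol_term_counit :: "pol_term \<Rightarrow> complex" where
  "pol_term_counit PZero = 0"
| "pol_term_counit POne = 1"
| "pol_term_counit PAlpha = 1"
| "pol_term_counit PGamma = 0"
| "pol_term_counit (PAdd x y) = pol_term_counit x + pol_term_counit y"
| "pol_term_counit (PMul x y) = pol_term_counit x * pol_term_counit y"
| "pol_term_counit (PScale c x) = c * pol_term_counit x"
| "pol_term_counit (PStar x) = cnj (pol_term_counit x)"

lemma pol_eq_counit: "pol_eq x y \<Longrightarrow> pol_term_counit x = pol_term_counit y"
  by (induction rule: pol_eq.induct) (auto simp: algebra_simps)

instantiation pol :: star_algebra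
begin

lift_definition zero_pol :: pol is PZero .
lift_definition one_pol :: pol is POne .
lift_definition plus_pol :: "pol \<Rightarrow> pol \<Rightarrow> pol" is PAdd by (rule pol_eq.cong_add)
lift_definition times_pol :: "pol \<Rightarrow> pol \<Rightarrow> pol" is PMul by (rule pol_eq.cong_mul)
lift_definition scaleC_pol :: "complex \<Rightarrow> pol \<Rightarrow> pol" is PScale by (rule pol_eq.cong_scale)
lift_definition star_pol :: "pol \<Rightarrow> pol" is PStar by (rule pol_eq.cong_star)
lift_definition uminus_pol :: "pol \<Rightarrow> pol" is "PScale (-1)" by (rule pol_eq.cong_scale)
lift_definition minus_pol :: "pol \<Rightarrow> pol \<Rightarrow> pol" is "\<lambda>x y. PAdd x (PScale (-1) y)"
  by (intro pol_eq.cong_add pol_eq.cong_scale)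

instance
proof
  show "(0::pol) \<noteq> 1"
    by transfer (use pol_eq_counit in force)
qed (transfer, rule pol_eq.add_assoc pol_eq.add_comm pol_eq.add_zero pol_eq.add_inv
    pol_eq.mul_assoc pol_eq.one_mul pol_eq.mul_one pol_eq.distrib_left pol_eq.distrib_right
    pol_eq.scale_add_right pol_eq.scale_add_left pol_eq.scale_scale pol_eq.scale_one
    pol_eq.scale_mul_left pol_eq.scale_mul_right pol_eq.star_star pol_eq.star_add
    pol_eq.star_mul pol_eq.star_scale pol_eq.refl)+

end

lift_definition pol_alpha :: pol is PAlpha .
lift_definition pol_gamma :: pol is PGamma .

lemma pol_relations:
  "pol_alpha * pol_gamma = 0"
  "pol_alpha * star pol_gamma = 0"
  "pol_gamma * star pol_gamma = star pol_gamma * pol_gamma"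
  "star pol_alpha * pol_alpha + star pol_gamma * pol_gamma = 1"
  "pol_alpha * star pol_alpha - star pol_alpha * pol_alpha = star pol_gamma * pol_gamma"
  by (transfer, rule pol_eq.alpha_gamma pol_eq.alpha_gamma_star pol_eq.gamma_normal
    pol_eq.unit_relation pol_eq.commutator_relation)+

definition pol_gamma_powi :: "int \<Rightarrow> pol"
  where "pol_gamma_powi k = (if k \<ge> 0 then pol_gamma ^ nat k else star pol_gamma ^ nat (- k))"

definition pol_monomial :: "nat \<Rightarrow> int \<Rightarrow> nat \<Rightarrow> pol"
  where "pol_monomial r k s = star pol_alpha ^ r * pol_gamma_powi k * pol_alpha ^ s"


section \<open>The C*-bialgebra C(SU_0(2)) and its quantum subgroups\<close>

text \<open>
  Throughout, \<open>\<iota>\<close> is the canonical map from Pol(SU_0(2)) into its enveloping C*-algebra. The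
  continuous extensions of the coproduct and of the counit are determined by their values at
  the generators.
\<close>

definition su0_coproduct ::
    "(pol \<Rightarrow> 'a::cstar_algebra) \<Rightarrow> ('a \<Rightarrow> 'a \<Rightarrow> 'b::cstar_algebra) \<Rightarrow> ('a \<Rightarrow> 'b) \<Rightarrow> bool"
  where "su0_coproduct \<iota> t \<Delta> \<longleftrightarrow> star_hom \<Delta> \<and> continuous_on UNIV \<Delta> \<and>
    \<Delta> (\<iota> pol_alpha) = t (\<iota> pol_alpha) (\<iota> pol_alpha) \<and>
    \<Delta> (\<iota> pol_gamma) =
      t (\<iota> pol_gamma) (\<iota> pol_alpha) + t (star (\<iota> pol_alpha)) (\<iota> pol_gamma)"

definition su0_counit :: "(pol \<Rightarrow> 'a::cstar_algebra) \<Rightarrow> ('a \<Rightarrow> complex) \<Rightarrow> bool"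
  where "su0_counit \<iota> \<epsilon> \<longleftrightarrow> star_hom \<epsilon> \<and> continuous_on UNIV \<epsilon> \<and>
    \<epsilon> (\<iota> pol_alpha) = 1 \<and> \<epsilon> (\<iota> pol_gamma) = 0"

text \<open>
  C(U(1)) consists of the functions that are continuous on the unit circle, with pointwise
  operations; values off the circle are irrelevant.
\<close>

definition su0_to_circle :: "(pol \<Rightarrow> 'a::cstar_algebra) \<Rightarrow> ('a \<Rightarrow> complex \<Rightarrow> complex) \<Rightarrow> bool"
  where "su0_to_circle \<iota> j \<longleftrightarrow>
    (\<forall>x. continuous_on (sphere 0 1) (j x)) \<and>
    (\<forall>z\<in>sphere 0 1. star_hom (\<lambda>x. j x z) \<and> j (\<iota> pol_alpha) z = z \<and> j (\<iota> pol_gamma) z = 0)"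

text \<open>Normalized Haar measure of a closed subgroup \<open>K\<close> of the unit circle.\<close>

definition haar_measure :: "complex set \<Rightarrow> complex measure"
  where "haar_measure K = (THE \<mu>. sets \<mu> = sets (restrict_space borel K) \<and>
    emeasure \<mu> (space \<mu>) = 1 \<and> (\<forall>z\<in>K. distr \<mu> \<mu> (\<lambda>w. z * w) = \<mu>))"

definition haar_state :: "('a \<Rightarrow> complex \<Rightarrow> complex) \<Rightarrow> complex set \<Rightarrow> 'a \<Rightarrow> complex"
  where "haar_state j K x = (\<integral>z. j x z \<partial>haar_measure K)"

definition su0_phi ::
    "('a \<Rightarrow> complex) \<Rightarrow> ('a \<Rightarrow> complex \<Rightarrow> complex) \<Rightarrow> enat \<Rightarrow> 'a \<Rightarrow> complex"
  where "su0_phi \<epsilon> j n =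
    (if n = 1 then \<epsilon>
     else if n = \<infinity> then haar_state j (sphere 0 1)
     else haar_state j {z. z ^ the_enat n = 1})"

definition is_su0_psi :: "(pol \<Rightarrow> 'a::cstar_algebra) \<Rightarrow> nat \<Rightarrow> ('a \<Rightarrow> complex) \<Rightarrow> bool"
  where "is_su0_psi \<iota> n \<psi> \<longleftrightarrow> clinear \<psi> \<and> continuous_on UNIV \<psi> \<and>
    (\<forall>r s k. \<psi> (\<iota> (pol_monomial r k s)) = (if k = 0 \<and> r = s \<and> r \<le> n then 1 else 0))"

definition su0_psi :: "(pol \<Rightarrow> 'a::cstar_algebra) \<Rightarrow> nat \<Rightarrow> 'a \<Rightarrow> complex"
  where "su0_psi \<iota> n = (THE \<psi>. is_su0_psi \<iota> n \<psi>)"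

end

theory Submission
  imports Defs "HOL-Library.Groups_Big_Fun"
begin

text \<open>
  Since \<open>\<Delta>(\<gamma>)\<^sup>k = \<Sum>\<^sub>i (\<alpha>\<^sup>*)\<^sup>i\<gamma>\<^sup>k\<^sup>-\<^sup>i \<otimes> \<gamma>\<^sup>i\<alpha>\<^sup>k\<^sup>-\<^sup>i\<close>, idempotency of a state \<open>\<phi>\<close> is a recursion for its
  values on the monomials. For \<open>k = 0\<close> it says that these values are idempotent numbers, i.e. 0 or 1,
  and by the Cauchy-Schwarz inequality and induction on \<open>k\<close> all values with \<open>k \<noteq> 0\<close> vanish. The
  numbers \<open>p\<^sub>m = \<phi>((\<alpha>\<^sup>*)\<^sup>m\<alpha>\<^sup>m) \<in> {0, 1}\<close> decrease. If all of them are 1, then \<open>\<phi>((\<alpha>\<^sup>*)\<^sup>r\<alpha>\<^sup>s)\<close>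
  depends only on \<open>s - r\<close> and is the indicator function of a subgroup of the integers, which gives
  some \<open>\<phi>\<^sub>n\<close>. If \<open>n\<close> is the last index with \<open>p\<^sub>n = 1\<close>, then an off-diagonal value 1 would propagate
  to arbitrarily large indices, so \<open>\<phi> = \<psi>\<^sub>n\<close>. Conversely, \<open>\<psi>\<^sub>n\<close> is the vector state at \<open>e\<^sub>n \<otimes> e\<^sub>0\<close> of the
  representation on \<open>\<ell>\<^sup>2(\<nat>) \<otimes> \<ell>\<^sup>2(\<int>)\<close>.
\<close>

text \<open>\<open>su0_psi\<close>, \<open>tensor_functional\<close> and \<open>haar_measure\<close>
  are definite descriptions, so each needs an existence and a uniqueness proof. The obstacle in the
  first two is boundedness: the norm of C(SU_0(2)) is known only as the largest C*-seminorm, that of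
  the tensor product only as the spatial norm. For \<psi>_n, the operator seminorm of left
  multiplication in the GNS construction is a C*-seminorm on \<open>pol\<close>, finite because
  \<alpha>*\<alpha> + \<gamma>*\<gamma> = 1 makes the generators contractions; it therefore lies
  below the enveloping norm, without completing any Hilbert space. For \<phi> \<otimes> \<phi>,
  positivity on algebraic tensors gives domination by the spatial norm.

  In the classification, positivity acts through null vectors. The difference p_s - p_{s+1} is the
  squared GNS norm of \<gamma>\<alpha>^s. Where it vanishes, monomials containing \<gamma>\<alpha>^s
  have value 0, and values at powers of \<alpha> can be moved along their diagonal. Likewise a value
  1 at \<alpha>^d makes \<alpha>^d fix the cyclic vector, which produces periodicity.\<close>

text \<open>The introduction rules of \<^const>\<open>pol_eq\<close> hide the following names.\<close>

lemmas distrib_left = semiring_class.distrib_left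
  and distrib_right = semiring_class.distrib_right
  and star_star = star_algebra_class.star_star
  and star_add = star_algebra_class.star_add
  and star_mult = star_algebra_class.star_mult

section \<open>Calculus of scalars, involution and linear maps\<close>

lemma scaleC_zero_left [simp]: "0 *\<^sub>C x = (0 :: 'a::star_algebra)"
  using scaleC_add_left[of 0 0 x] by simp

lemma scaleC_zero_right [simp]: "c *\<^sub>C 0 = (0 :: 'a::star_algebra)"
  using scaleC_add_right[of c 0 0] by simp

lemma scaleC_minus1: "(-1) *\<^sub>C x = - (x :: 'a::star_algebra)"
proof -
  have "x + (-1) *\<^sub>C x = 0"
    using scaleC_add_left[of 1 "-1" x] by (simp add: scaleC_one)
  then show ?thesis
    by (simp add: eq_neg_iff_add_eq_0 add.commute)
qed

lemma star_zero [simp]: "star 0 = (0 :: 'a::star_algebra)"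
  using star_scaleC[of 0 "0::'a"] by simp

lemma star_one [simp]: "star 1 = (1 :: 'a::star_algebra)"
  by (metis mult.right_neutral star_mult star_star)

lemma star_minus: "star (- x) = - star (x :: 'a::star_algebra)"
  using star_scaleC[of "-1" x] by (simp add: scaleC_minus1)

lemma star_diff: "star (x - y) = star x - star (y :: 'a::star_algebra)"
  using star_add[of x "- y"] by (simp add: star_minus)

lemma star_power: "star (x ^ n) = star (x :: 'a::star_algebra) ^ n"
  by (induction n) (simp_all add: star_mult power_commutes)

lemma clinear_add: "clinear f \<Longrightarrow> f (x + y) = f x + f y"
  by (simp add: clinear_def)

lemma clinear_scaleC: "clinear f \<Longrightarrow> f (c *\<^sub>C x) = c *\<^sub>C f x"
  by (simp add: clinear_def)

lemma clinear_zero: "clinear f \<Longrightarrow> f 0 = 0"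
  by (metis clinear_scaleC scaleC_zero_left)

lemma clinear_minus: "clinear f \<Longrightarrow> f (- x) = - f x"
  by (metis clinear_scaleC scaleC_minus1)

lemma clinear_diff: "clinear f \<Longrightarrow> f (x - y) = f x - f y"
  using clinear_add[of f x "- y"] by (simp add: clinear_minus)

lemma clinear_sum: "clinear f \<Longrightarrow> f (sum g I) = (\<Sum>i\<in>I. f (g i))"
  by (induction I rule: infinite_finite_induct) (simp_all add: clinear_zero clinear_add)

lemma clinear_comp: "clinear f \<Longrightarrow> clinear g \<Longrightarrow> clinear (\<lambda>x. f (g x))"
  by (simp add: clinear_def)

lemmas clinear_simps = clinear_add clinear_scaleC clinear_zero clinear_minus clinear_diff

lemma star_sum: "star (sum g I) = (\<Sum>i\<in>I. star (g i :: 'a::star_algebra))"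
  by (induction I rule: infinite_finite_induct) (simp_all add: star_add)

lemma star_homD:
  assumes "star_hom f"
  shows "clinear f" "f 1 = 1" "f (x * y) = f x * f y" "f (star x) = star (f x)"
  using assms by (auto simp: star_hom_def)

lemma star_hom_power: "star_hom f \<Longrightarrow> f (x ^ n) = f x ^ n"
  by (induction n) (simp_all add: star_homD)

lemma star_hom_comp: "star_hom f \<Longrightarrow> star_hom g \<Longrightarrow> star_hom (\<lambda>x. f (g x))"
  by (simp add: star_hom_def clinear_def)

section \<open>Positive functionals\<close>

text \<open>Unlike \<open>state\<close>, this demands neither continuity nor normalization, so it
  makes sense on \<open>pol\<close>, which carries no norm.\<close>

definition positive_functional :: "('a::star_algebra \<Rightarrow> complex) \<Rightarrow> bool"
  where "positive_functional f \<longleftrightarrow> clinear f \<and> (\<forall>x. f (star x * x) \<in> \<real>\<^sub>\<ge>\<^sub>0)"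

lemma state_positive: "state \<phi> \<Longrightarrow> positive_functional \<phi>"
  by (simp add: state_def positive_functional_def)

lemma star_hom_positive:
  assumes "star_hom (f :: 'a::star_algebra \<Rightarrow> complex)"
  shows "positive_functional f"
  using assms by (auto simp: positive_functional_def star_homD star_complex_def
      complex_nonneg_Reals_iff complex_mult_cnj mult.commute)

lemma positive_functionalD:
  assumes "positive_functional f"
  shows "clinear f" "0 \<le> Re (f (star x * x))" "Im (f (star x * x)) = 0"
  using assms by (auto simp: positive_functional_def complex_nonneg_Reals_iff)

lemma positive_functional_cross:
  assumes "positive_functional f"
  shows "f (star (x + c *\<^sub>C y) * (x + c *\<^sub>C y)) =
    f (star x * x) + c * f (star x * y) + cnj c * f (star y * x) + cnj c * c * f (star y * y)"
  using positive_functionalD(1)[OF assms]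
  by (simp add: star_add star_scaleC distrib_left distrib_right mult_scaleC_left mult_scaleC_right
      clinear_simps scaleC_complex_def algebra_simps)

text \<open>Polarization: the form is real on x + c y, so the imaginary part of the two cross terms
  must cancel. Taking c = 1 settles the imaginary parts and c = \<i> the real parts.\<close>

lemma positive_functional_hermitian:
  assumes "positive_functional f"
  shows "f (star y * x) = cnj (f (star x * y))"
proof (rule complex_eqI)
  note im = positive_functionalD(3)[OF assms]
  show "Im (f (star y * x)) = Im (cnj (f (star x * y)))"
    using im[of "x + 1 *\<^sub>C y"] im[of x] im[of y]
    by (simp only: positive_functional_cross[OF assms]) simp
  show "Re (f (star y * x)) = Re (cnj (f (star x * y)))"
    using im[of "x + \<i> *\<^sub>C y"] im[of x] im[of y]
    by (simp only: positive_functional_cross[OF assms]) simp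
qed

lemma positive_functional_star:
  assumes "positive_functional f"
  shows "f (star x) = cnj (f x)"
  using positive_functional_hermitian[OF assms, of x 1] by simp

lemma positive_functional_cauchy_schwarz:
  assumes "positive_functional f"
  shows "(cmod (f (star x * y)))\<^sup>2 \<le> Re (f (star x * x)) * Re (f (star y * y))"
proof -
  define a b d where "a = Re (f (star x * x))" and "b = f (star x * y)"
    and "d = Re (f (star y * y))"
  have eq: "f (star x * x) = of_real a" "f (star y * y) = of_real d" "f (star y * x) = cnj b"
    using positive_functionalD(3)[OF assms] positive_functional_hermitian[OF assms, of y x]
    by (simp_all add: a_def d_def b_def complex_eq_iff)
  have a: "a \<ge> 0" and d: "d \<ge> 0"
    using positive_functionalD(2)[OF assms] by (auto simp: a_def d_def)
  have main: "0 \<le> a + 2 * Re (c * b) + (cmod c)\<^sup>2 * d" for c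
  proof -
    have "Re (f (star (x + c *\<^sub>C y) * (x + c *\<^sub>C y))) = a + 2 * Re (c * b) + (cmod c)\<^sup>2 * d"
      unfolding positive_functional_cross[OF assms] eq b_def[symmetric]
      by (simp add: cmod_def power2_eq_square algebra_simps)
    then show ?thesis
      by (metis positive_functionalD(2)[OF assms])
  qed
  \<comment> \<open>The choice c = -s cnj b aligns the phase, so that c b = -s |b|^2 and only the
    real parameter s is left. The minimum is at s = 1/d; for d = 0 and b nonzero, the value of s
    used below makes the right-hand side equal to -1.\<close>
  have expand: "a + 2 * Re (- of_real s * cnj b * b) + (cmod (- of_real s * cnj b))\<^sup>2 * d
      = a - 2 * s * (cmod b)\<^sup>2 + s\<^sup>2 * (cmod b)\<^sup>2 * d" for s
    by (simp add: norm_mult power_mult_distrib)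
       (simp add: cmod_def power2_eq_square algebra_simps)
  have main': "0 \<le> a - 2 * s * (cmod b)\<^sup>2 + s\<^sup>2 * (cmod b)\<^sup>2 * d" for s
    using main[of "- of_real s * cnj b"] unfolding expand .
  have "(cmod b)\<^sup>2 \<le> a * d"
  proof (cases "d = 0")
    case True
    have "b = 0"
    proof (rule ccontr)
      assume "b \<noteq> 0"
      then show False
        using main'[of "(a + 1) / (2 * (cmod b)\<^sup>2)"] True by simp
    qed
    then show ?thesis using True by simp
  next
    case False
    then show ?thesis
      using main'[of "1 / d"] d by (simp add: field_simps power2_eq_square)
  qed
  then show ?thesis
    by (simp add: a_def b_def d_def)
qed

text \<open>By Cauchy-Schwarz, \<open>y\<close> represents the zero vector of the GNS space. This is
  how positivity is turned into equations between values of \<open>f\<close>.\<close>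

lemma positive_functional_null:
  assumes "positive_functional f" "f (star y * y) = 0"
  shows "f (x * y) = 0" "f (star y * x) = 0"
proof -
  show "f (x * y) = 0"
    using positive_functional_cauchy_schwarz[OF assms(1), of "star x" y] assms(2)
    by (simp add: star_star)
  show "f (star y * x) = 0"
    using positive_functional_cauchy_schwarz[OF assms(1), of y x] assms(2) by simp
qed

section \<open>The operator seminorm of the GNS construction\<close>

definition gns_seminorm :: "('a::star_algebra \<Rightarrow> complex) \<Rightarrow> 'a \<Rightarrow> real"
  where "gns_seminorm f x = sqrt (Re (f (star x * x)))"

lemma gns_seminorm_nonneg: "positive_functional f \<Longrightarrow> 0 \<le> gns_seminorm f x"
  by (simp add: gns_seminorm_def positive_functionalD)

lemma gns_seminorm_sq: "positive_functional f \<Longrightarrow> (gns_seminorm f x)\<^sup>2 = Re (f (star x * x))"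
  by (simp add: gns_seminorm_def positive_functionalD)

lemma gns_seminorm_cauchy_schwarz:
  assumes "positive_functional f"
  shows "cmod (f (star x * y)) \<le> gns_seminorm f x * gns_seminorm f y"
  by (rule power2_le_imp_le)
     (use positive_functional_cauchy_schwarz[OF assms] in
       \<open>auto simp: power_mult_distrib gns_seminorm_sq assms gns_seminorm_nonneg\<close>)

lemma gns_seminorm_triangle:
  assumes "positive_functional f"
  shows "gns_seminorm f (x + y) \<le> gns_seminorm f x + gns_seminorm f y"
proof (rule power2_le_imp_le)
  have "(gns_seminorm f (x + y))\<^sup>2 =
      (gns_seminorm f x)\<^sup>2 + (gns_seminorm f y)\<^sup>2 + 2 * Re (f (star x * y))"
    using positive_functional_cross[OF assms, of x 1 y] positive_functional_hermitian[OF assms, of y x]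
    by (simp add: gns_seminorm_sq assms scaleC_one)
  also have "\<dots> \<le> (gns_seminorm f x + gns_seminorm f y)\<^sup>2"
    using gns_seminorm_cauchy_schwarz[OF assms, of x y] complex_Re_le_cmod[of "f (star x * y)"]
    by (simp add: power2_sum)
  finally show "(gns_seminorm f (x + y))\<^sup>2 \<le> \<dots>" .
qed (simp add: gns_seminorm_nonneg assms)

lemma gns_seminorm_scaleC:
  assumes "positive_functional f"
  shows "gns_seminorm f (c *\<^sub>C x) = cmod c * gns_seminorm f x"
proof -
  have "f (star (c *\<^sub>C x) * (c *\<^sub>C x)) = of_real ((cmod c)\<^sup>2) * f (star x * x)"
    using positive_functionalD(1)[OF assms] unfolding complex_norm_square
    by (simp add: star_scaleC mult_scaleC_left mult_scaleC_right clinear_simps scaleC_complex_def)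
  then show ?thesis
    by (simp add: gns_seminorm_def real_sqrt_mult)
qed

text \<open>The operator norm of left multiplication by \<open>x\<close> on the GNS pre-Hilbert
  space. On a general star-algebra this supremum may be infinite, which is why the following context
  assumes each left multiplication to be bounded; for \<open>pol\<close> this is
  \<open>gns_seminorm_pol_bounded\<close>.\<close>

definition gns_opnorm :: "('a::star_algebra \<Rightarrow> complex) \<Rightarrow> 'a \<Rightarrow> real"
  where "gns_opnorm f x = Sup {gns_seminorm f (x * y) | y. gns_seminorm f y \<le> 1}"

context
  fixes f :: "'a::star_algebra \<Rightarrow> complex"
  assumes pos: "positive_functional f"
    and bounded: "\<And>x. \<exists>C. \<forall>y. gns_seminorm f (x * y) \<le> C * gns_seminorm f y"
begin

lemma gns_opnorm_bdd: "bdd_above {gns_seminorm f (x * y) | y. gns_seminorm f y \<le> 1}"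
proof -
  obtain C where C: "\<And>y. gns_seminorm f (x * y) \<le> C * gns_seminorm f y"
    using bounded by blast
  have "gns_seminorm f (x * y) \<le> \<bar>C\<bar>" if "gns_seminorm f y \<le> 1" for y
  proof -
    have "C * gns_seminorm f y \<le> \<bar>C\<bar> * 1"
      by (rule mult_mono) (use that gns_seminorm_nonneg[OF pos] in auto)
    then show ?thesis using C[of y] by simp
  qed
  then show ?thesis
    by (auto intro: bdd_aboveI[of _ "\<bar>C\<bar>"])
qed

lemma gns_seminorm_zero: "gns_seminorm f 0 = 0"
  using gns_seminorm_scaleC[OF pos, of 0 0] by simp

lemma gns_opnorm_nonneg: "0 \<le> gns_opnorm f x"
  unfolding gns_opnorm_def
  by (rule cSup_upper2[OF _ _ gns_opnorm_bdd, of "gns_seminorm f (x * 0)"])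
     (auto simp: gns_seminorm_zero intro!: exI[of _ 0])

lemma gns_opnorm: "gns_seminorm f (x * y) \<le> gns_opnorm f x * gns_seminorm f y"
proof (cases "gns_seminorm f y = 0")
  case True
  then show ?thesis
    using bounded[of x] gns_seminorm_nonneg[OF pos] by (metis mult_zero_right)
next
  case False
  define c where "c = complex_of_real (1 / gns_seminorm f y)"
  have N: "gns_seminorm f y > 0"
    using False gns_seminorm_nonneg[OF pos, of y] by simp
  then have c: "cmod c = 1 / gns_seminorm f y"
    by (simp only: c_def norm_of_real) simp
  have "gns_seminorm f (x * (c *\<^sub>C y)) \<le> gns_opnorm f x"
    unfolding gns_opnorm_def
    by (rule cSup_upper[OF _ gns_opnorm_bdd])
       (use N in \<open>auto intro!: exI[of _ "c *\<^sub>C y"] simp: gns_seminorm_scaleC[OF pos] c\<close>)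
  then show ?thesis
    using N by (simp add: mult_scaleC_right gns_seminorm_scaleC[OF pos] c field_simps)
qed

lemma gns_opnorm_le:
  assumes "0 \<le> C" "\<And>y. gns_seminorm f (x * y) \<le> C * gns_seminorm f y"
  shows "gns_opnorm f x \<le> C"
  unfolding gns_opnorm_def
proof (rule cSup_least)
  show "{gns_seminorm f (x * y) | y. gns_seminorm f y \<le> 1} \<noteq> {}"
    by (auto intro!: exI[of _ 0] simp: gns_seminorm_zero)
next
  fix r assume "r \<in> {gns_seminorm f (x * y) | y. gns_seminorm f y \<le> 1}"
  then obtain y where y: "r = gns_seminorm f (x * y)" "gns_seminorm f y \<le> 1"
    by blast
  have "C * gns_seminorm f y \<le> C"
    using assms(1) y(2) by (simp add: mult_left_le)
  then show "r \<le> C"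
    using assms(2)[of y] y(1) by simp
qed

lemma gns_opnorm_mult: "gns_opnorm f (x * y) \<le> gns_opnorm f x * gns_opnorm f y"
proof (rule gns_opnorm_le)
  fix z
  have "gns_seminorm f (x * (y * z)) \<le> gns_opnorm f x * gns_seminorm f (y * z)"
    by (rule gns_opnorm)
  also have "\<dots> \<le> gns_opnorm f x * (gns_opnorm f y * gns_seminorm f z)"
    by (intro mult_left_mono gns_opnorm gns_opnorm_nonneg)
  finally show "gns_seminorm f (x * y * z) \<le> gns_opnorm f x * gns_opnorm f y * gns_seminorm f z"
    by (simp add: mult.assoc)
qed (simp add: gns_opnorm_nonneg)

lemma gns_opnorm_scaleC: "gns_opnorm f (c *\<^sub>C x) = cmod c * gns_opnorm f x"
proof -
  have le: "gns_opnorm f (c *\<^sub>C x) \<le> cmod c * gns_opnorm f x" for c x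
    by (rule gns_opnorm_le)
       (auto simp: gns_opnorm_nonneg mult_scaleC_left gns_seminorm_scaleC[OF pos] mult.assoc
         intro!: mult_left_mono gns_opnorm)
  show ?thesis
  proof (cases "c = 0")
    case True
    then show ?thesis using le[of 0 x] gns_opnorm_nonneg[of 0] by simp
  next
    case False
    have "gns_opnorm f x \<le> cmod (inverse c) * gns_opnorm f (c *\<^sub>C x)"
      using le[of "inverse c" "c *\<^sub>C x"] False by (simp add: scaleC_scaleC scaleC_one)
    then have "cmod c * gns_opnorm f x \<le> gns_opnorm f (c *\<^sub>C x)"
      using False unfolding norm_inverse by (simp add: field_simps)
    then show ?thesis
      using le[of c x] by simp
  qed
qed

text \<open>From |xy|^2 = <y, x*xy> and Cauchy-Schwarz, the square of the norm of x is at most the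
  norm of x*x. Submultiplicativity then shows that x and its adjoint have equal norms, and this
  gives the reverse estimate.\<close>

lemma gns_opnorm_star: "gns_opnorm f (star x * x) = (gns_opnorm f x)\<^sup>2"
proof -
  have sq: "(gns_opnorm f x)\<^sup>2 \<le> gns_opnorm f (star x * x)" for x
  proof -
    have "gns_opnorm f x \<le> sqrt (gns_opnorm f (star x * x))"
    proof (rule gns_opnorm_le)
      fix y
      have "(gns_seminorm f (x * y))\<^sup>2 = Re (f (star y * (star x * x * y)))"
        by (simp add: gns_seminorm_sq pos star_mult mult.assoc)
      also have "\<dots> \<le> gns_seminorm f y * gns_seminorm f (star x * x * y)"
        using gns_seminorm_cauchy_schwarz[OF pos] complex_Re_le_cmod order_trans by blast
      also have "\<dots> \<le> gns_seminorm f y * (gns_opnorm f (star x * x) * gns_seminorm f y)"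
        by (intro mult_left_mono gns_opnorm gns_seminorm_nonneg pos)
      also have "\<dots> = (sqrt (gns_opnorm f (star x * x)) * gns_seminorm f y)\<^sup>2"
        by (simp add: power_mult_distrib gns_opnorm_nonneg power2_eq_square)
      finally show "gns_seminorm f (x * y) \<le> sqrt (gns_opnorm f (star x * x)) * gns_seminorm f y"
        by (rule power2_le_imp_le) (simp add: gns_opnorm_nonneg gns_seminorm_nonneg pos)
    qed (simp add: gns_opnorm_nonneg)
    then have "(gns_opnorm f x)\<^sup>2 \<le> (sqrt (gns_opnorm f (star x * x)))\<^sup>2"
      by (rule power_mono) (rule gns_opnorm_nonneg)
    then show ?thesis by (simp add: gns_opnorm_nonneg)
  qed
  have le: "gns_opnorm f x \<le> gns_opnorm f (star x)" for x
  proof (cases "gns_opnorm f x = 0")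
    case True
    then show ?thesis
      by (simp add: gns_opnorm_nonneg)
  next
    case False
    have "gns_opnorm f x * gns_opnorm f x \<le> gns_opnorm f (star x) * gns_opnorm f x"
      using sq[of x] gns_opnorm_mult[of "star x" x] by (simp add: power2_eq_square)
    then show ?thesis
      using False gns_opnorm_nonneg[of x] by simp
  qed
  have "gns_opnorm f (star x) = gns_opnorm f x"
    using le[of x] le[of "star x"] by (simp add: star_star)
  then show ?thesis
    using sq[of x] gns_opnorm_mult[of "star x" x] by (simp add: power2_eq_square)
qed

lemma cstar_seminorm_gns_opnorm: "cstar_seminorm (gns_opnorm f)"
  unfolding cstar_seminorm_def
proof (intro conjI allI)
  fix x y
  show "gns_opnorm f (x + y) \<le> gns_opnorm f x + gns_opnorm f y"
  proof (rule gns_opnorm_le)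
    fix z
    show "gns_seminorm f ((x + y) * z) \<le> (gns_opnorm f x + gns_opnorm f y) * gns_seminorm f z"
      using gns_seminorm_triangle[OF pos, of "x * z" "y * z"] gns_opnorm[of x z] gns_opnorm[of y z]
      by (simp add: distrib_right)
  qed (simp add: gns_opnorm_nonneg)
qed (simp_all add: gns_opnorm_nonneg gns_opnorm_mult gns_opnorm_scaleC gns_opnorm_star)

text \<open>\<open>f x\<close> is the inner product of the unit vector 1 with x applied to 1, hence
  bounded by the operator seminorm of x, and the enveloping norm dominates every C*-seminorm. This
  is what lets functionals on \<open>pol\<close> extend to C(SU_0(2)).\<close>

lemma positive_functional_le_cstar_norm:
  fixes \<iota> :: "'a \<Rightarrow> 'c::cstar_algebra"
  assumes "enveloping_cstar \<iota>" "f 1 = 1"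
  shows "cmod (f x) \<le> norm (\<iota> x)"
proof -
  have one: "gns_seminorm f 1 = 1"
    by (simp add: gns_seminorm_def assms)
  have "cmod (f x) \<le> gns_seminorm f x"
    using gns_seminorm_cauchy_schwarz[OF pos, of 1 x] one by simp
  also have "\<dots> \<le> gns_opnorm f x"
    using gns_opnorm[of x 1] one by simp
  also have "\<dots> \<le> norm (\<iota> x)"
    using assms(1) cstar_seminorm_gns_opnorm by (simp add: enveloping_cstar_def)
  finally show ?thesis .
qed

end

section \<open>Extension from dense subspaces\<close>

lemma clinear_norm_bound_continuous:
  fixes F :: "'b::cstar_algebra \<Rightarrow> complex"
  assumes "clinear F" "\<And>x. cmod (F x) \<le> C * norm x"
  shows "continuous_on UNIV F"
proof -
  have "bounded_linear F"
    by (rule bounded_linear_intro[of _ C])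
       (use assms in \<open>simp_all add: clinear_simps scaleR_scaleC[where 'a = 'b] scaleC_complex_def
          scaleR_conv_of_real mult.commute\<close>)
  then show ?thesis
    by (rule linear_continuous_on)
qed

lemma continuous_eq_of_dense:
  fixes F G :: "'b::topological_space \<Rightarrow> 'c::t2_space"
  assumes "continuous_on UNIV F" "continuous_on UNIV G" "closure (range L) = UNIV"
    and "\<And>i. F (L i) = G (L i)"
  shows "F = G"
proof -
  have "closed {x. F x = G x}"
    using assms(1,2) by (rule closed_Collect_eq)
  then have "closure (range L) \<subseteq> {x. F x = G x}"
    by (rule closure_minimal[rotated]) (use assms(4) in auto)
  then show ?thesis
    using assms(3) by auto
qed

text \<open>The index type need not be a vector space: it may only represent the elements of one.\<close>

lemma clinear_extension:
  fixes L :: "'i \<Rightarrow> 'b::cstar_algebra" and f :: "'i \<Rightarrow> complex"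
  assumes dense: "closure (range L) = UNIV"
    and add: "\<And>i k. \<exists>l. L l = L i + L k \<and> f l = f i + f k"
    and scale: "\<And>c i. \<exists>l. L l = c *\<^sub>C L i \<and> f l = c * f i"
    and bound: "\<And>i. cmod (f i) \<le> norm (L i)"
  shows "\<exists>F. clinear F \<and> continuous_on UNIV F \<and> (\<forall>i. F (L i) = f i)"
proof -
  \<comment> \<open>The bound at an index representing the difference. It shows at once that
    \<open>f\<close> is constant on the fibres of \<open>L\<close>, so that the choice in
    \<open>g\<close> below is harmless, and that \<open>g\<close> is uniformly continuous.\<close>
  have lip: "cmod (f i - f k) \<le> norm (L i - L k)" for i k
  proof -
    obtain k' where k': "L k' = (-1) *\<^sub>C L k" "f k' = (-1) * f k"
      using scale by blast
    obtain l where "L l = L i + L k'" "f l = f i + f k'"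
      using add by blast
    then show ?thesis
      using k' bound[of l] by (simp add: scaleC_minus1)
  qed
  define g where "g x = f (SOME i. L i = x)" for x
  have g: "g (L i) = f i" for i
  proof -
    have "L (SOME k. L k = L i) = L i"
      by (rule someI) simp
    then show ?thesis
      using lip[of "SOME k. L k = L i" i] by (simp add: g_def)
  qed
  have "uniformly_continuous_on (range L) g"
    unfolding uniformly_continuous_on_def
    using lip by (auto simp: g dist_norm intro: le_less_trans)
  then obtain F where F: "uniformly_continuous_on (closure (range L)) F"
      "\<And>x. x \<in> range L \<Longrightarrow> g x = F x"
    using uniformly_continuous_on_extension_on_closure by metis
  have cont: "continuous_on UNIV F"
    using F(1) dense uniformly_continuous_imp_continuous by metis
  have FL: "F (L i) = f i" for i
    using F(2)[of "L i"] g by simp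
  \<comment> \<open>Additivity is an identity in two variables, so it is extended by continuity from
    a dense subset of the product space.\<close>
  have dense2: "closure (range (map_prod L L)) = UNIV"
  proof -
    have "range (map_prod L L) = range L \<times> range L"
      by auto
    then show ?thesis
      using dense by (simp add: closure_Times)
  qed
  have contc: "continuous_on A (\<lambda>x. F (h x))" if "continuous_on A h" for A and h :: "'z::topological_space \<Rightarrow> 'b"
    by (rule continuous_on_compose2[OF cont that]) auto
  have sc: "continuous_on UNIV (\<lambda>x::'b. c *\<^sub>C x)" for c
  proof -
    have "bounded_linear (\<lambda>x::'b. c *\<^sub>C x)"
      by (rule bounded_linear_intro[of _ "cmod c"])
         (simp_all add: scaleC_add_right scaleR_scaleC scaleC_scaleC norm_scaleC mult.commute)
    then show ?thesis by (rule linear_continuous_on)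
  qed
  have "(\<lambda>p. F (fst p + snd p)) = (\<lambda>p. F (fst p) + F (snd p))"
  proof (rule continuous_eq_of_dense[OF _ _ dense2])
    fix p :: "'i \<times> 'i"
    obtain l where "L l = L (fst p) + L (snd p)" "f l = f (fst p) + f (snd p)"
      using add by blast
    then show "F (fst (map_prod L L p) + snd (map_prod L L p)) =
        F (fst (map_prod L L p)) + F (snd (map_prod L L p))"
      using FL[of l] by (cases p) (simp add: FL)
  qed (intro continuous_intros contc)+
  then have "F (x + y) = F x + F y" for x y
    by (auto dest: fun_cong[of _ _ "(x, y)"])
  moreover have "(\<lambda>x. F (c *\<^sub>C x)) = (\<lambda>x. c * F x)" for c
  proof (rule continuous_eq_of_dense[OF _ _ dense])
    fix i
    show "F (c *\<^sub>C L i) = c * F (L i)"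
      using scale[of c i] FL by metis
  qed (intro continuous_intros contc sc cont)+
  then have "F (c *\<^sub>C x) = c * F x" for c x
    by meson
  ultimately show ?thesis
    using cont FL by (auto simp: clinear_def scaleC_complex_def)
qed

section \<open>Monomials in Pol(SU_0(2))\<close>

lemma pol_induct [case_names one alpha gamma alpha_star gamma_star add mult scaleC]:
  assumes one: "P 1"
    and gens: "P pol_alpha" "P pol_gamma" "P (star pol_alpha)" "P (star pol_gamma)"
    and add: "\<And>x y. P x \<Longrightarrow> P y \<Longrightarrow> P (x + y)"
    and mult: "\<And>x y. P x \<Longrightarrow> P y \<Longrightarrow> P (x * y)"
    and scaleC: "\<And>c x. P x \<Longrightarrow> P (c *\<^sub>C x)"
  shows "P x"
proof -
  have zero: "P 0"
    using scaleC[OF one, of 0] by simp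
  \<comment> \<open>Carrying the adjoint along pushes all stars down to the generators; this is why
    no star case appears among the premises.\<close>
  have "P (abs_pol u) \<and> P (star (abs_pol u))" for u
  proof (induction u)
    case PZero
    then show ?case using zero by (simp add: zero_pol_def[symmetric])
  next
    case POne
    then show ?case using one by (simp add: one_pol_def[symmetric])
  next
    case PAlpha
    then show ?case using gens by (simp add: pol_alpha_def[symmetric])
  next
    case PGamma
    then show ?case using gens by (simp add: pol_gamma_def[symmetric])
  next
    case (PAdd u v)
    then show ?case using add by (simp add: plus_pol.abs_eq[symmetric] star_add)
  next
    case (PMul u v)
    then show ?case using mult by (simp add: times_pol.abs_eq[symmetric] star_mult)
  next
    case (PScale c u)
    then show ?case using scaleC by (simp add: scaleC_pol.abs_eq[symmetric] star_scaleC)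
  next
    case (PStar u)
    then show ?case by (simp add: star_pol.abs_eq[symmetric] star_star)
  qed
  then show ?thesis
    using Quotient_abs_rep[OF Quotient_pol, of x] by metis
qed

section \<open>Normal ordering of words in the generators\<close>

lemma pol_star_relations:
  "star pol_gamma * star pol_alpha = 0"
  "pol_gamma * star pol_alpha = 0"
  "star pol_alpha * pol_alpha = 1 - star pol_gamma * pol_gamma"
  "star pol_gamma * pol_gamma = 1 - star pol_alpha * pol_alpha"
  "pol_alpha * star pol_alpha = 1"
  using arg_cong[OF pol_relations(1), of star] arg_cong[OF pol_relations(2), of star]
    pol_relations(4,5)
  by (simp_all add: star_mult star_star algebra_simps)

text \<open>Replace \<gamma>*\<gamma> by 1 - \<alpha>*\<alpha>; both \<gamma> and its adjoint
  annihilate \<alpha>* from the left.\<close>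

lemma pol_gamma_partial_isometry:
  "pol_gamma * (star pol_gamma * pol_gamma) = pol_gamma"
  "star pol_gamma * (star pol_gamma * pol_gamma) = star pol_gamma"
  by (simp_all add: pol_star_relations(4) right_diff_distrib pol_star_relations(1,2)
      flip: mult.assoc)

lemma pol_alpha_power_gamma:
  "pol_alpha ^ Suc s * pol_gamma = 0" "pol_alpha ^ Suc s * star pol_gamma = 0"
  by (simp_all add: power_Suc2 mult.assoc pol_relations del: power_Suc)

lemma pol_alpha_power_star: "pol_alpha ^ Suc s * star pol_alpha = pol_alpha ^ s"
  by (simp add: power_Suc2 mult.assoc pol_star_relations(5) del: power_Suc)

lemma pol_gamma_powi_0 [simp]: "pol_gamma_powi 0 = 1"
  by (simp add: pol_gamma_powi_def)

lemma pol_gamma_powi_nat: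
  "pol_gamma_powi (int n) = pol_gamma ^ n" "pol_gamma_powi (- int n) = star pol_gamma ^ n"
  by (simp_all add: pol_gamma_powi_def)

lemma pol_gamma_powi_alpha_star: "k \<noteq> 0 \<Longrightarrow> pol_gamma_powi k * star pol_alpha = 0"
proof -
  assume "k \<noteq> 0"
  then obtain n where "nat k = Suc n \<and> k \<ge> 0 \<or> nat (- k) = Suc n \<and> k < 0"
    by (metis linorder_less_linear not_less zero_less_nat_eq gr0_implies_Suc neg_0_less_iff_less)
  then show ?thesis
    by (auto simp: pol_gamma_powi_def power_Suc2 mult.assoc pol_star_relations simp del: power_Suc)
qed

lemma star_pol_gamma_powi: "star (pol_gamma_powi k) = pol_gamma_powi (- k)"
  by (auto simp: pol_gamma_powi_def star_power star_star)

lemma star_pol_monomial: "star (pol_monomial r k s) = pol_monomial s (- k) r"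
  by (simp add: pol_monomial_def star_mult star_power star_star star_pol_gamma_powi mult.assoc)

text \<open>Integer powers of \<gamma> multiply like those of a unitary on the range of the
  projection \<gamma>*\<gamma> = 1 - \<alpha>*\<alpha>. The exceptional case arises because the
  zeroth power is by convention 1 and not this projection.\<close>

lemma pol_gamma_powi_mult_gamma:
  "pol_gamma_powi k * pol_gamma =
    (if k = -1 then 1 - star pol_alpha * pol_alpha else pol_gamma_powi (k + 1))"
proof -
  consider n where "k = int n" | "k = -1" | n where "k = - int (Suc (Suc n))" "k + 1 = - int (Suc n)"
  proof -
    note cases = that
    have "k \<ge> 0 \<or> k = -1 \<or> k \<le> -2"
      by arith
    moreover have ?thesis if "k \<ge> 0"
      using that by (intro cases(1)[of "nat k"]) simp
    moreover have ?thesis if "k \<le> -2"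
      using that by (intro cases(3)[of "nat (- k - 2)"]) simp_all
    ultimately show ?thesis
      using cases(2) by blast
  qed
  then show ?thesis
  proof cases
    case (1 n)
    then have eq: "k + 1 = int (Suc n)" and ne: "k \<noteq> -1" by simp_all
    have "pol_gamma_powi (k + 1) = pol_gamma ^ n * pol_gamma"
      unfolding eq pol_gamma_powi_nat by (rule power_Suc2)
    moreover have "pol_gamma_powi k = pol_gamma ^ n"
      unfolding 1 by (rule pol_gamma_powi_nat)
    ultimately show ?thesis
      using ne by simp
  next
    case 2
    then show ?thesis
      by (simp add: pol_gamma_powi_def pol_star_relations(4))
  next
    case (3 n)
    have "pol_gamma_powi (k + 1) = star pol_gamma ^ Suc n"
      unfolding 3(2) by (rule pol_gamma_powi_nat)
    moreover have "pol_gamma_powi k = star pol_gamma ^ Suc (Suc n)"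
      unfolding 3(1) by (rule pol_gamma_powi_nat)
    moreover have "star pol_gamma ^ Suc (Suc n) * pol_gamma = star pol_gamma ^ Suc n"
      by (simp add: power_Suc2 mult.assoc pol_gamma_partial_isometry del: power_Suc)
    ultimately show ?thesis
      using 3(1) by simp
  qed
qed

lemma pol_gamma_powi_mult_gamma_star:
  "pol_gamma_powi k * star pol_gamma =
    (if k = 1 then 1 - star pol_alpha * pol_alpha else pol_gamma_powi (k - 1))"
proof -
  consider n where "k = - int n" | "k = 1" | n where "k = int (Suc (Suc n))" "k - 1 = int (Suc n)"
  proof -
    note cases = that
    have "k \<le> 0 \<or> k = 1 \<or> k \<ge> 2"
      by arith
    moreover have ?thesis if "k \<le> 0"
      using that by (intro cases(1)[of "nat (- k)"]) simp
    moreover have ?thesis if "k \<ge> 2"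
      using that by (intro cases(3)[of "nat (k - 2)"]) simp_all
    ultimately show ?thesis
      using cases(2) by blast
  qed
  then show ?thesis
  proof cases
    case (1 n)
    then have eq: "k - 1 = - int (Suc n)" and ne: "k \<noteq> 1" by simp_all
    have "pol_gamma_powi (k - 1) = star pol_gamma ^ n * star pol_gamma"
      unfolding eq pol_gamma_powi_nat by (rule power_Suc2)
    moreover have "pol_gamma_powi k = star pol_gamma ^ n"
      unfolding 1 by (rule pol_gamma_powi_nat)
    ultimately show ?thesis
      using ne by simp
  next
    case 2
    then show ?thesis
      by (simp add: pol_gamma_powi_def pol_star_relations(4) pol_relations(3))
  next
    case (3 n)
    have "pol_gamma_powi (k - 1) = pol_gamma ^ Suc n"
      unfolding 3(2) by (rule pol_gamma_powi_nat)
    moreover have "pol_gamma_powi k = pol_gamma ^ Suc (Suc n)"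
      unfolding 3(1) by (rule pol_gamma_powi_nat)
    moreover have "pol_gamma ^ Suc (Suc n) * star pol_gamma = pol_gamma ^ Suc n"
      by (simp add: power_Suc2 mult.assoc pol_relations(3) pol_gamma_partial_isometry del: power_Suc)
    ultimately show ?thesis
      using 3(1) by simp
  qed
qed

inductive_set monomial_span :: "pol set" where
  monomial: "pol_monomial r k s \<in> monomial_span"
| add: "x \<in> monomial_span \<Longrightarrow> y \<in> monomial_span \<Longrightarrow> x + y \<in> monomial_span"
| scaleC: "x \<in> monomial_span \<Longrightarrow> c *\<^sub>C x \<in> monomial_span"

lemma monomial_span_zero: "0 \<in> monomial_span"
  using monomial_span.scaleC[OF monomial_span.monomial[of 0 0 0], of 0] by simp

lemma monomial_span_diff: "x \<in> monomial_span \<Longrightarrow> y \<in> monomial_span \<Longrightarrow> x - y \<in> monomial_span"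
  using monomial_span.add[OF _ monomial_span.scaleC[of y "-1"]] by (simp add: scaleC_minus1)

lemma monomial_span_defect:
  "star pol_alpha ^ r * (1 - star pol_alpha * pol_alpha) \<in> monomial_span"
proof -
  have "star pol_alpha ^ r * (1 - star pol_alpha * pol_alpha) =
      pol_monomial r 0 0 - pol_monomial (Suc r) 0 1"
    by (simp add: pol_monomial_def right_diff_distrib power_Suc2 mult.assoc del: power_Suc)
  then show ?thesis
    by (simp add: monomial_span_diff monomial_span.monomial)
qed

text \<open>One normal-ordering step each: \<alpha>\<alpha>* = 1 cancels, \<alpha>\<gamma> =
  \<alpha>\<gamma>* = 0 and \<gamma>\<alpha>* = 0 kill, and a single \<gamma> meeting its adjoint
  leaves the projection treated in \<open>monomial_span_defect\<close>.\<close>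

lemma monomial_span_generators:
  assumes "g \<in> {pol_alpha, pol_gamma, star pol_alpha, star pol_gamma}"
  shows "pol_monomial r k s * g \<in> monomial_span"
proof -
  have "pol_monomial r k s * pol_alpha = pol_monomial r k (Suc s)"
    by (simp add: pol_monomial_def power_Suc2 mult.assoc del: power_Suc)
  moreover have "pol_monomial r k s * star pol_alpha =
      (if s > 0 then pol_monomial r k (s - 1) else if k = 0 then pol_monomial (Suc r) 0 0 else 0)"
  proof (cases s)
    case 0
    then show ?thesis
      by (simp add: pol_monomial_def mult.assoc pol_gamma_powi_alpha_star power_Suc2 del: power_Suc)
  next
    case (Suc m)
    then show ?thesis
      by (simp add: pol_monomial_def mult.assoc pol_alpha_power_star del: power_Suc)
  qed
  moreover have "pol_monomial r k s * pol_gamma = (if s > 0 then 0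
      else if k = -1 then star pol_alpha ^ r * (1 - star pol_alpha * pol_alpha)
      else pol_monomial r (k + 1) 0)"
    by (cases s) (simp_all add: pol_monomial_def mult.assoc pol_alpha_power_gamma
        pol_gamma_powi_mult_gamma del: power_Suc)
  moreover have "pol_monomial r k s * star pol_gamma = (if s > 0 then 0
      else if k = 1 then star pol_alpha ^ r * (1 - star pol_alpha * pol_alpha)
      else pol_monomial r (k - 1) 0)"
    by (cases s) (simp_all add: pol_monomial_def mult.assoc pol_alpha_power_gamma
        pol_gamma_powi_mult_gamma_star del: power_Suc)
  ultimately show ?thesis
    using assms by (auto simp: monomial_span.monomial monomial_span_zero monomial_span_defect)
qed

text \<open>The span contains 1 and is a right ideal: stability under right multiplication passes
  from the generators to sums, products and multiples by \<open>pol_induct\<close>.\<close>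

lemma monomial_span_UNIV: "x \<in> monomial_span"
proof -
  have gens: "y * g \<in> monomial_span"
    if "g \<in> {pol_alpha, pol_gamma, star pol_alpha, star pol_gamma}" "y \<in> monomial_span" for g y
    using that(2)
    by induction
       (use monomial_span_generators[OF that(1)] in
        \<open>auto simp: distrib_right mult_scaleC_left intro: monomial_span.intros\<close>)
  have "\<forall>y\<in>monomial_span. y * x \<in> monomial_span"
    by (induction x rule: pol_induct)
       (auto simp: gens distrib_left mult_scaleC_right mult.assoc[symmetric] intro: monomial_span.intros)
  moreover have "1 \<in> monomial_span"
    using monomial_span.monomial[of 0 0 0] by (simp add: pol_monomial_def)
  ultimately show ?thesis by force
qed

lemma clinear_eq_on_monomials:
  assumes "clinear f" "clinear g" "\<And>r k s. f (pol_monomial r k s) = g (pol_monomial r k s)"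
  shows "f x = g x"
  using monomial_span_UNIV[of x]
  by induction (use assms in \<open>auto simp: clinear_simps\<close>)

section \<open>The functionals \<psi>_n on Pol(SU_0(2))\<close>

text \<open>Serves the adjointness of the shifts below. The one-sided shift of indices is not
  surjective, so the terms it misses have to vanish.\<close>

lemma Sum_any_reindex:
  assumes "inj h" "\<And>i. i \<notin> range h \<Longrightarrow> g i = 0"
  shows "Sum_any g = Sum_any (\<lambda>i. g (h i))"
proof -
  have "{i. g i \<noteq> 0} = h ` {i. g (h i) \<noteq> 0}"
    using assms(2) by force
  then show ?thesis
    using assms(1) by (simp add: Sum_any.expand_set sum.reindex inj_on_subset)
qed

text \<open>
  The representation with \<open>\<alpha>\<close> acting as the backward shift on \<open>\<ell>\<^sup>2(\<nat>) \<otimes> \<ell>\<^sup>2(\<int>)\<close> and \<open>\<gamma>\<close> as the bilateral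
  shift of the second leg on \<open>e\<^sub>0 \<otimes> \<ell>\<^sup>2(\<int>)\<close> and as 0 on its complement. The Boolean selects the
  operator (\<open>True\<close>) or its adjoint (\<open>False\<close>).
\<close>

primrec pol_term_action ::
    "pol_term \<Rightarrow> bool \<Rightarrow> (nat \<times> int \<Rightarrow> complex) \<Rightarrow> nat \<times> int \<Rightarrow> complex" where
  "pol_term_action PZero b v = (\<lambda>i. 0)"
| "pol_term_action POne b v = v"
| "pol_term_action PAlpha b v = (\<lambda>(n, k).
    if b then v (Suc n, k) else case n of 0 \<Rightarrow> 0 | Suc m \<Rightarrow> v (m, k))"
| "pol_term_action PGamma b v = (\<lambda>(n, k).
    if n = 0 then v (0, if b then k - 1 else k + 1) else 0)"
| "pol_term_action (PAdd x y) b v = (\<lambda>i. pol_term_action x b v i + pol_term_action y b v i)"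
| "pol_term_action (PMul x y) b v =
    (if b then pol_term_action x b (pol_term_action y b v)
     else pol_term_action y b (pol_term_action x b v))"
| "pol_term_action (PScale c x) b v = (\<lambda>i. (if b then c else cnj c) * pol_term_action x b v i)"
| "pol_term_action (PStar x) b v = pol_term_action x (\<not> b) v"

lemma pol_term_action_add:
  "pol_term_action x b (\<lambda>i. u i + v i) = (\<lambda>i. pol_term_action x b u i + pol_term_action x b v i)"
  by (induction x arbitrary: b u v) (simp_all, auto simp: fun_eq_iff algebra_simps split: nat.split)

lemma pol_term_action_scale:
  "pol_term_action x b (\<lambda>i. c * v i) = (\<lambda>i. c * pol_term_action x b v i)"
  by (induction x arbitrary: b v) (simp_all, auto simp: fun_eq_iff algebra_simps split: nat.split)

lemma pol_term_action_zero: "pol_term_action x b (\<lambda>i. 0) = (\<lambda>i. 0)"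
  using pol_term_action_scale[of x b 0 "\<lambda>i. 0"] by simp

text \<open>The relations already hold on arbitrary functions, so no summability enters. Operator
  and formal adjoint are handled together because the star rules of \<open>pol_eq\<close> exchange
  them.\<close>

lemma pol_eq_action: "pol_eq x y \<Longrightarrow> pol_term_action x b v = pol_term_action y b v"
  by (induction arbitrary: b v rule: pol_eq.induct)
     (simp_all add: pol_term_action_add pol_term_action_scale pol_term_action_zero,
       auto simp: fun_eq_iff algebra_simps split: nat.split)

lift_definition pol_action :: "pol \<Rightarrow> (nat \<times> int \<Rightarrow> complex) \<Rightarrow> nat \<times> int \<Rightarrow> complex"
  is "\<lambda>x. pol_term_action x True"
  by (intro ext) (simp add: pol_eq_action)

lemma pol_action_simps:
  "pol_action 1 v = v"
  "pol_action (x + y) v = (\<lambda>i. pol_action x v i + pol_action y v i)"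
  "pol_action (x * y) v = pol_action x (pol_action y v)"
  "pol_action (c *\<^sub>C x) v = (\<lambda>i. c * pol_action x v i)"
  "pol_action pol_alpha v = (\<lambda>(n, k). v (Suc n, k))"
  "pol_action (star pol_alpha) v = (\<lambda>(n, k). case n of 0 \<Rightarrow> 0 | Suc m \<Rightarrow> v (m, k))"
  "pol_action pol_gamma v = (\<lambda>(n, k). if n = 0 then v (0, k - 1) else 0)"
  "pol_action (star pol_gamma) v = (\<lambda>(n, k). if n = 0 then v (0, k + 1) else 0)"
proof -
  obtain s t where [simp]: "x = abs_pol s" "y = abs_pol t"
    using Quotient_abs_rep[OF Quotient_pol] by metis
  show "pol_action 1 v = v"
    by (simp add: one_pol_def pol_action.abs_eq)
  show "pol_action (x + y) v = (\<lambda>i. pol_action x v i + pol_action y v i)"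
    by (simp add: plus_pol.abs_eq pol_action.abs_eq)
  show "pol_action (x * y) v = pol_action x (pol_action y v)"
    by (simp add: times_pol.abs_eq pol_action.abs_eq)
  show "pol_action (c *\<^sub>C x) v = (\<lambda>i. c * pol_action x v i)"
    by (simp add: scaleC_pol.abs_eq pol_action.abs_eq)
qed (auto simp: fun_eq_iff pol_alpha_def pol_gamma_def star_pol.abs_eq pol_action.abs_eq)

lemma finite_support_pol_term_action:
  "finite {i. v i \<noteq> 0} \<Longrightarrow> finite {i. pol_term_action x b v i \<noteq> 0}"
proof (induction x arbitrary: b v)
  case PAlpha
  \<comment> \<open>For the backward shift the truncated subtraction sends index 0 to 0 instead of
    discarding it; this only enlarges the finite superset.\<close>
  have "{i. pol_term_action PAlpha b v i \<noteq> 0} \<subseteq>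
      (\<lambda>i. (if b then fst i - 1 else Suc (fst i), snd i)) ` {i. v i \<noteq> 0}"
  proof (rule subsetI)
    fix i assume i: "i \<in> {i. pol_term_action PAlpha b v i \<noteq> 0}"
    obtain n k where "i = (n, k)"
      by (cases i)
    note i = i this
    show "i \<in> (\<lambda>i. (if b then fst i - 1 else Suc (fst i), snd i)) ` {i. v i \<noteq> 0}"
      by (rule image_eqI[of _ _ "(if b then Suc (fst i) else fst i - 1, snd i)"])
         (use i in \<open>auto split: nat.splits if_splits\<close>)
  qed
  then show ?case
    by (rule finite_subset) (simp add: PAlpha)
next
  case PGamma
  have "{i. pol_term_action PGamma b v i \<noteq> 0} \<subseteq>
      (\<lambda>i. (fst i, if b then snd i + 1 else snd i - 1)) ` {i. v i \<noteq> 0}"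
  proof (rule subsetI)
    fix i assume i: "i \<in> {i. pol_term_action PGamma b v i \<noteq> 0}"
    obtain n k where "i = (n, k)"
      by (cases i)
    note i = i this
    show "i \<in> (\<lambda>i. (fst i, if b then snd i + 1 else snd i - 1)) ` {i. v i \<noteq> 0}"
      by (rule image_eqI[of _ _ "(fst i, if b then snd i - 1 else snd i + 1)"])
         (use i in \<open>auto split: if_splits\<close>)
  qed
  then show ?case
    by (rule finite_subset) (simp add: PGamma)
next
  case (PAdd x y)
  have "{i. pol_term_action (PAdd x y) b v i \<noteq> 0} \<subseteq>
      {i. pol_term_action x b v i \<noteq> 0} \<union> {i. pol_term_action y b v i \<noteq> 0}"
    by auto
  then show ?case
    by (rule finite_subset) (simp add: PAdd)
next
  case (PScale c x)
  have "{i. pol_term_action (PScale c x) b v i \<noteq> 0} \<subseteq> {i. pol_term_action x b v i \<noteq> 0}"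
    by auto
  then show ?case
    by (rule finite_subset) (simp add: PScale)
qed auto

text \<open>The formal adjoint is the adjoint for the inner product of finitely supported vectors.
  Finite support is what makes \<open>Sum_any\<close> additive.\<close>

lemma pol_term_action_adjoint:
  assumes "finite {i. u i \<noteq> 0}" "finite {i. v i \<noteq> 0}"
  shows "Sum_any (\<lambda>i. cnj (pol_term_action x (\<not> b) u i) * v i) =
    Sum_any (\<lambda>i. cnj (u i) * pol_term_action x b v i)"
  using assms
proof (induction x arbitrary: b u v)
  case PZero
  then show ?case by simp
next
  case POne
  then show ?case by simp
next
  case PAlpha
  let ?h = "\<lambda>p :: nat \<times> int. (Suc (fst p), snd p)"
  have inj: "inj ?h"
    by (auto simp: inj_on_def)
  have off: "fst i = 0" if "i \<notin> range ?h" for i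
    using that by (cases i; cases "fst i") (auto simp: image_iff)
  \<comment> \<open>The side to reindex is the one with the forward shift, i.e. the action of
    \<alpha>*, whose values off the range of the index shift are 0.\<close>
  show ?case
  proof (cases b)
    case True
    then show ?thesis
      by (subst Sum_any_reindex[OF inj]) (auto simp: case_prod_unfold dest!: off)
  next
    case False
    then show ?thesis
      by (subst (2) Sum_any_reindex[OF inj]) (auto simp: case_prod_unfold dest!: off)
  qed
next
  case PGamma
  have inj: "inj (\<lambda>(n :: nat, k). (n, k + 1 :: int))"
    by (auto simp: inj_on_def)
  have range: "i \<in> range (\<lambda>(n :: nat, k). (n, k + 1 :: int))" for i
    by (cases i) (auto simp: image_iff intro: exI[of _ "snd i - 1"])
  show ?case
  proof (cases b)
    case True
    then show ?thesis
      by (subst (2) Sum_any_reindex[OF inj]) (use range in \<open>auto intro!: Sum_any.cong\<close>)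
  next
    case False
    then show ?thesis
      by (subst Sum_any_reindex[OF inj]) (use range in \<open>auto intro!: Sum_any.cong\<close>)
  qed
next
  case (PAdd x y)
  have fin: "finite {i. cnj (pol_term_action z (\<not> b) u i) * v i \<noteq> 0}"
    "finite {i. cnj (u i) * pol_term_action z b v i \<noteq> 0}" for z
    by (rule finite_subset[OF _ PAdd.prems(2)], force)
       (rule finite_subset[OF _ PAdd.prems(1)], force)
  show ?case
    using PAdd.IH[OF PAdd.prems, of b]
    unfolding pol_term_action.simps complex_cnj_add distrib_left distrib_right
    by (subst (1 2) Sum_any.distrib) (rule fin | simp)+
next
  case (PMul x y)
  note fin = finite_support_pol_term_action
  show ?case
    using PMul.IH(1)[of "pol_term_action y (\<not> b) u" v b] PMul.IH(1)[of u "pol_term_action y b v" b]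
      PMul.IH(2)[of "pol_term_action x (\<not> b) u" v b] PMul.IH(2)[of u "pol_term_action x b v" b]
      PMul.prems fin
    by (cases b) simp_all
next
  case (PScale c x)
  have fin: "finite {i. cnj (pol_term_action x (\<not> b) u i) * v i \<noteq> 0}"
    "finite {i. cnj (u i) * pol_term_action x b v i \<noteq> 0}"
    by (rule finite_subset[OF _ PScale.prems(2)], force)
       (rule finite_subset[OF _ PScale.prems(1)], force)
  define d where "d = (if b then c else cnj c)"
  have "Sum_any (\<lambda>i. d * (cnj (pol_term_action x (\<not> b) u i) * v i)) =
      Sum_any (\<lambda>i. d * (cnj (u i) * pol_term_action x b v i))"
    using PScale.IH[OF PScale.prems, of b]
    unfolding Sum_any_right_distrib[OF fin(1), symmetric] Sum_any_right_distrib[OF fin(2), symmetric]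
    by simp
  then show ?case
    by (cases b) (simp_all add: d_def mult_ac)
next
  case (PStar x)
  then show ?case
    using PStar.IH[of u v "\<not> b"] by simp
qed

definition pol_psi :: "nat \<Rightarrow> pol \<Rightarrow> complex"
  where "pol_psi n x = pol_action x (\<lambda>i. if i = (n, 0) then 1 else 0) (n, 0)"

text \<open>The value at \<open>star x * x\<close> is the squared norm of the vector that
  \<open>x\<close> makes out of the basis vector; by finite support this is a finite sum.\<close>

lemma positive_functional_pol_psi: "positive_functional (pol_psi n)"
  unfolding positive_functional_def
proof (intro conjI allI)
  show "clinear (pol_psi n)"
    by (simp add: clinear_def pol_psi_def pol_action_simps scaleC_complex_def)
next
  fix x
  let ?e = "\<lambda>i. if i = (n, 0 :: int) then 1 else 0 :: complex"
  define w where "w = pol_action x ?e"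
  have fin: "finite {i. w i \<noteq> 0}"
    unfolding w_def by transfer (rule finite_support_pol_term_action, simp)
  have "pol_psi n (star x * x) = Sum_any (\<lambda>i. cnj (?e i) * pol_action (star x) w i)"
  proof -
    have "Sum_any (\<lambda>i. cnj (?e i) * g i) = g (n, 0)" for g
    proof -
      have "Sum_any (\<lambda>i. cnj (?e i) * g i) = (\<Sum>i\<in>{(n, 0)}. cnj (?e i) * g i)"
        by (rule Sum_any.expand_superset) auto
      then show ?thesis by simp
    qed
    then show ?thesis
      by (simp add: pol_psi_def pol_action_simps w_def)
  qed
  also have "\<dots> = Sum_any (\<lambda>i. cnj (w i) * w i)"
  proof -
    obtain u where "x = abs_pol u"
      using Quotient_abs_rep[OF Quotient_pol] by metis
    then have "Sum_any (\<lambda>i. cnj (?e i) * pol_action (star x) v i) = Sum_any (\<lambda>i. cnj (pol_action x ?e i) * v i)"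
      if "finite {i. v i \<noteq> 0}" for v
      using pol_term_action_adjoint[of ?e v u False] that
      by (simp add: star_pol.abs_eq pol_action.abs_eq)
    then show ?thesis
      using fin by (simp add: w_def)
  qed
  also have "\<dots> = of_real (\<Sum>i | w i \<noteq> 0. (cmod (w i))\<^sup>2)"
    by (simp add: Sum_any.expand_set complex_norm_square mult.commute del: of_real_power)
  finally show "pol_psi n (star x * x) \<in> \<real>\<^sub>\<ge>\<^sub>0"
    by (simp only: nonneg_Reals_of_real_iff) (simp add: sum_nonneg)
qed

lemma pol_action_alpha_power: "pol_action (pol_alpha ^ s) v (n, k) = v (n + s, k)"
  by (induction s arbitrary: n) (simp_all add: pol_action_simps)

lemma pol_action_alpha_star_power:
  "pol_action (star pol_alpha ^ r) v (n, k) = (if r \<le> n then v (n - r, k) else 0)"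
  by (induction r arbitrary: n) (auto simp: pol_action_simps split: nat.split)

lemma pol_action_gamma_powi:
  assumes "k \<noteq> 0"
  shows "pol_action (pol_gamma_powi k) v (n, l) = (if n = 0 then v (0, l - k) else 0)"
proof -
  have "pol_action (pol_gamma ^ Suc m) v (n, l) = (if n = 0 then v (0, l - int (Suc m)) else 0)"
    "pol_action (star pol_gamma ^ Suc m) v (n, l) = (if n = 0 then v (0, l + int (Suc m)) else 0)"
    for m
    by (induction m arbitrary: n l) (auto simp: pol_action_simps algebra_simps)
  note * = this
  show ?thesis
  proof (cases "k > 0")
    case True
    then obtain m where "k = int (Suc m)"
      by (metis gr0_implies_Suc zero_less_imp_eq_int)
    then show ?thesis using *(1)[of m] by (simp only: pol_gamma_powi_nat)
  next
    case False
    with assms obtain m where "k = - int (Suc m)"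
      by (metis gr0_implies_Suc zero_less_imp_eq_int linorder_neqE_linordered_idom minus_equation_iff neg_0_less_iff_less)
    then show ?thesis using *(2)[of m] by (simp only: pol_gamma_powi_nat) (simp add: algebra_simps)
  qed
qed

text \<open>\<alpha>^s lowers the first coordinate n by s or kills the vector, a nonzero power of
  \<gamma> moves the second coordinate, and the power of \<alpha>* raises the first one by r. The
  starting vector reappears only for k = 0 and r = s \<le> n.\<close>

lemma pol_psi_monomial:
  "pol_psi n (pol_monomial r k s) = (if k = 0 \<and> r = s \<and> r \<le> n then 1 else 0)"
  by (cases "k = 0")
     (auto simp: pol_psi_def pol_monomial_def pol_action_simps pol_action_alpha_power
       pol_action_alpha_star_power pol_action_gamma_powi)

text \<open>The relation \<alpha>*\<alpha> + \<gamma>*\<gamma> = 1 reads |y|^2 = |\<alpha>y|^2 +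
  |\<gamma>y|^2, so \<alpha> and \<gamma> are contractions in every GNS seminorm. Moreover \<alpha>*
  is isometric because \<alpha>\<alpha>* = 1, and \<gamma>* is as large as \<gamma> by normality.
  Bounds for the generators propagate to all elements.\<close>

lemma gns_seminorm_pol_bounded:
  assumes "positive_functional f"
  shows "\<exists>C. \<forall>y. gns_seminorm f (x * y) \<le> C * gns_seminorm f (y :: pol)"
proof -
  note nonneg = gns_seminorm_nonneg[OF assms]
  have alpha: "gns_seminorm f (pol_alpha * y) \<le> gns_seminorm f y"
    and gamma: "gns_seminorm f (pol_gamma * y) \<le> gns_seminorm f y" for y
  proof -
    have "star y * y = star (pol_alpha * y) * (pol_alpha * y) + star (pol_gamma * y) * (pol_gamma * y)"
      by (simp add: star_mult mult.assoc flip: distrib_left)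
         (simp add: pol_relations(4) flip: mult.assoc distrib_right)
    then have "Re (f (star y * y)) = Re (f (star (pol_alpha * y) * (pol_alpha * y)))
        + Re (f (star (pol_gamma * y) * (pol_gamma * y)))"
      by (simp add: clinear_add[OF positive_functionalD(1)[OF assms]])
    then show "gns_seminorm f (pol_alpha * y) \<le> gns_seminorm f y"
        "gns_seminorm f (pol_gamma * y) \<le> gns_seminorm f y"
      using positive_functionalD(2)[OF assms] by (simp_all add: gns_seminorm_def)
  qed
  have alpha_star: "gns_seminorm f (star pol_alpha * y) = gns_seminorm f y" for y
    by (simp add: gns_seminorm_def star_mult star_star mult.assoc)
       (simp add: pol_star_relations(5) flip: mult.assoc)
  have gamma_star: "gns_seminorm f (star pol_gamma * y) = gns_seminorm f (pol_gamma * y)" for y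
    by (simp add: gns_seminorm_def star_mult star_star mult.assoc)
       (simp add: pol_relations(3) flip: mult.assoc)
  have "\<exists>C\<ge>0. \<forall>y. gns_seminorm f (x * y) \<le> C * gns_seminorm f y"
  proof (induction x rule: pol_induct)
    case (add x z)
    then obtain C D where "C \<ge> 0" "D \<ge> 0" "\<And>y. gns_seminorm f (x * y) \<le> C * gns_seminorm f y"
      "\<And>y. gns_seminorm f (z * y) \<le> D * gns_seminorm f y"
      by blast
    then show ?case
      using gns_seminorm_triangle[OF assms, of "x * y" "z * y" for y]
      by (intro exI[of _ "C + D"]) (simp add: distrib_right, meson add_mono order_trans)
  next
    case (mult x z)
    then obtain C D where *: "C \<ge> 0" "D \<ge> 0" "\<And>y. gns_seminorm f (x * y) \<le> C * gns_seminorm f y"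
      "\<And>y. gns_seminorm f (z * y) \<le> D * gns_seminorm f y"
      by blast
    then show ?case
      by (intro exI[of _ "C * D"])
         (simp add: mult.assoc, meson mult_left_mono order_trans)
  next
    case (scaleC c x)
    then obtain C where "C \<ge> 0" "\<And>y. gns_seminorm f (x * y) \<le> C * gns_seminorm f y"
      by blast
    then show ?case
      by (intro exI[of _ "cmod c * C"])
         (simp add: mult_scaleC_left gns_seminorm_scaleC[OF assms] mult.assoc mult_left_mono)
  qed (use alpha gamma in \<open>auto simp: alpha_star gamma_star intro!: exI[of _ 1]\<close>)
  then show ?thesis by blast
qed

section \<open>Product functionals on the spatial tensor product\<close>

text \<open>
  This is the Schur product theorem for the Gram matrices of \<open>a\<close> and \<open>b\<close>. Splitting the component
  along \<open>b k\<close> off the remaining \<open>b i\<close> and moving it into the coefficient of \<open>b k\<close> leaves the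
  algebraic tensor unchanged and diagonalizes the form.
\<close>

lemma schur_product_nonneg:
  fixes a :: "'i \<Rightarrow> 'a::star_algebra" and b :: "'i \<Rightarrow> 'b::star_algebra"
  assumes pos: "positive_functional \<phi>" "positive_functional \<psi>" and "finite I"
  shows "(\<Sum>i\<in>I. \<Sum>l\<in>I. \<phi> (star (a i) * a l) * \<psi> (star (b i) * b l)) \<in> \<real>\<^sub>\<ge>\<^sub>0"
  using \<open>finite I\<close>
proof (induction I arbitrary: b)
  case empty
  then show ?case by simp
next
  case (insert k I)
  note lin = positive_functionalD(1)[OF pos(1)] positive_functionalD(1)[OF pos(2)]
  define e where "e = \<psi> (star (b k) * b k)"
  have e: "e \<in> \<real>\<^sub>\<ge>\<^sub>0" "cnj e = e"
    using positive_functionalD(2,3)[OF pos(2)]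
    by (auto simp: e_def complex_nonneg_Reals_iff complex_eq_iff)
  define Q where "Q b = (\<Sum>i\<in>I. \<Sum>l\<in>I. \<phi> (star (a i) * a l) * \<psi> (star (b i) * b l))" for b
  have split: "(\<Sum>i\<in>insert k I. \<Sum>l\<in>insert k I. \<phi> (star (a i) * a l) * \<psi> (star (b i) * b l)) =
      \<phi> (star (a k) * a k) * e + (\<Sum>l\<in>I. \<phi> (star (a k) * a l) * \<psi> (star (b k) * b l))
      + (\<Sum>i\<in>I. \<phi> (star (a i) * a k) * \<psi> (star (b i) * b k)) + Q b"
    using insert.hyps by (simp add: Q_def e_def sum.distrib)
  show ?case
  proof (cases "e = 0")
    case True
    then have "\<psi> (star (b k) * x) = 0" "\<psi> (x * b k) = 0" for x
      using positive_functional_null[OF pos(2)] unfolding e_def by blast+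
    then show ?thesis
      unfolding split using insert.IH[of b] True by (simp add: Q_def)
  next
    case False
    \<comment> \<open>\<open>t i\<close> is the coefficient of \<open>b i\<close> along
      \<open>b k\<close> and \<open>b' i\<close> the orthogonal remainder. The tensor becomes (a k +
      A) \<otimes> b k plus the sum of a i \<otimes> b' i, without cross terms.\<close>
    define t where "t i = \<psi> (star (b k) * b i) / e" for i
    define b' where "b' i = b i - t i *\<^sub>C b k" for i
    define A where "A = (\<Sum>i\<in>I. t i *\<^sub>C a i)"
    have te: "\<psi> (star (b k) * b i) = t i * e" "\<psi> (star (b i) * b k) = cnj (t i) * e" for i
      using False e(2) positive_functional_hermitian[OF pos(2), of "b i" "b k"] by (simp_all add: t_def)
    have tk: "t k = 1"
      using False by (simp add: t_def e_def)
    have b': "\<psi> (star (b' i) * b' l) = \<psi> (star (b i) * b l) - cnj (t i) * t l * e" for i l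
      by (simp add: b'_def star_diff star_scaleC left_diff_distrib right_diff_distrib
          mult_scaleC_left mult_scaleC_right clinear_simps lin te tk scaleC_complex_def)
    have AA: "\<phi> (star A * A) = (\<Sum>i\<in>I. \<Sum>l\<in>I. cnj (t i) * t l * \<phi> (star (a i) * a l))"
      by (simp add: A_def star_sum star_scaleC sum_distrib_left sum_distrib_right clinear_sum lin
          mult_scaleC_left mult_scaleC_right clinear_simps scaleC_complex_def mult.assoc)
         (subst sum.swap, simp add: mult.left_commute)
    have kA: "\<phi> (star (a k) * A) * e = (\<Sum>l\<in>I. \<phi> (star (a k) * a l) * \<psi> (star (b k) * b l))"
      by (simp add: A_def sum_distrib_left sum_distrib_right clinear_sum lin te
          mult_scaleC_right clinear_simps scaleC_complex_def mult_ac)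
    have Ak: "\<phi> (star A * a k) * e = (\<Sum>i\<in>I. \<phi> (star (a i) * a k) * \<psi> (star (b i) * b k))"
      by (simp add: A_def star_sum star_scaleC sum_distrib_left sum_distrib_right clinear_sum lin te
          mult_scaleC_left clinear_simps scaleC_complex_def mult_ac)
    have "Q b' = Q b - \<phi> (star A * A) * e"
      by (simp add: Q_def b' AA right_diff_distrib sum_subtractf sum_distrib_left sum_distrib_right mult_ac)
    then have "(\<Sum>i\<in>insert k I. \<Sum>l\<in>insert k I. \<phi> (star (a i) * a l) * \<psi> (star (b i) * b l)) =
        \<phi> (star (a k + A) * (a k + A)) * e + Q b'"
      unfolding split
      by (simp add: star_add distrib_left distrib_right clinear_simps lin kA Ak)
    moreover have "\<phi> (star (a k + A) * (a k + A)) * e \<in> \<real>\<^sub>\<ge>\<^sub>0"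
      using pos(1) e(1) by (simp add: positive_functional_def nonneg_Reals_mult_I)
    moreover have "Q b' \<in> \<real>\<^sub>\<ge>\<^sub>0"
      unfolding Q_def by (rule insert.IH)
    ultimately show ?thesis
      by (simp add: nonneg_Reals_add_I)
  qed
qed

section \<open>The product functional and the spatial norm\<close>

lemma ten_functional_mult_star:
  "ten_functional \<phi> \<psi> (ten_mult (ten_star us) vs) =
    (\<Sum>(a, b)\<leftarrow>us. \<Sum>(c, d)\<leftarrow>vs. \<phi> (star a * c) * \<psi> (star b * d))"
proof (induction us)
  case Nil
  then show ?case by (simp add: ten_functional_def ten_mult_def ten_star_def)
next
  case (Cons u us)
  have "ten_functional \<phi> \<psi> (map (\<lambda>(c, d). (x * c, y * d)) vs) = (\<Sum>(c, d)\<leftarrow>vs. \<phi> (x * c) * \<psi> (y * d))"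
    for x y
    by (induction vs) (auto simp: ten_functional_def)
  then show ?case
    using Cons by (cases u) (simp add: ten_functional_def ten_mult_def ten_star_def)
qed

lemma ten_functional_positive:
  assumes "positive_functional \<phi>" "positive_functional \<psi>"
  shows "ten_functional \<phi> \<psi> (ten_mult (ten_star us) us) \<in> \<real>\<^sub>\<ge>\<^sub>0"
  using schur_product_nonneg[OF assms, of "{0..<length us}" "\<lambda>i. fst (us ! i)" "\<lambda>i. snd (us ! i)"]
  by (simp add: ten_functional_mult_star sum_list_sum_nth case_prod_unfold)

text \<open>Nonnegativity of the variance: positivity is applied to u - T (1 \<otimes> 1), where T
  is the value at u. In terms of lists, this prepends the pair
  \<open>(-T *\<^sub>C 1, 1)\<close>.\<close>

lemma ten_functional_cauchy_schwarz:
  assumes "positive_functional \<phi>" "positive_functional \<psi>" "\<phi> 1 = 1" "\<psi> 1 = 1"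
  shows "(cmod (ten_functional \<phi> \<psi> us))\<^sup>2 \<le> Re (ten_functional \<phi> \<psi> (ten_mult (ten_star us) us))"
proof -
  note lin = positive_functionalD(1)[OF assms(1)] positive_functionalD(1)[OF assms(2)]
  define T where "T = ten_functional \<phi> \<psi> us"
  let ?c = "- T"
  have T: "(\<Sum>(a, b)\<leftarrow>us. \<phi> a * \<psi> b) = T"
    by (simp add: T_def ten_functional_def)
  have T': "(\<Sum>(a, b)\<leftarrow>us. \<phi> (star a) * \<psi> (star b)) = cnj T"
    unfolding T[symmetric]
    by (induction us) (auto simp: positive_functional_star assms)
  have "ten_functional \<phi> \<psi> (ten_mult (ten_star ((?c *\<^sub>C 1, 1) # us)) ((?c *\<^sub>C 1, 1) # us)) =
     cnj ?c * ?c + cnj ?c * T + ?c * cnj T + ten_functional \<phi> \<psi> (ten_mult (ten_star us) us)"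
  proof -
    have 1: "(\<Sum>(a, b)\<leftarrow>us. \<phi> (star a * (?c *\<^sub>C 1)) * \<psi> (star b * 1)) = ?c * cnj T"
      unfolding T'[symmetric] sum_list_const_mult[symmetric]
      by (simp add: case_prod_unfold mult_scaleC_right clinear_simps lin scaleC_complex_def mult.assoc)
    have 2: "(\<Sum>(a, b)\<leftarrow>us. \<phi> (star (?c *\<^sub>C 1) * a) * \<psi> (star 1 * b)) = cnj ?c * T"
      unfolding T[symmetric] sum_list_const_mult[symmetric]
      by (simp add: case_prod_unfold mult_scaleC_left star_scaleC clinear_simps lin scaleC_complex_def mult.assoc)
    have "\<phi> (star (?c *\<^sub>C 1) * (?c *\<^sub>C 1)) * \<psi> (star 1 * 1) = cnj ?c * ?c"
      by (simp add: mult_scaleC_left mult_scaleC_right star_scaleC clinear_simps lin scaleC_complex_def assms)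
    with 1 2 show ?thesis
      unfolding ten_functional_mult_star
      by (simp add: case_prod_unfold sum_list_addf)
  qed
  moreover have "Re (ten_functional \<phi> \<psi> (ten_mult (ten_star ((?c *\<^sub>C 1, 1) # us)) ((?c *\<^sub>C 1, 1) # us))) \<ge> 0"
    using ten_functional_positive[OF assms(1,2)] complex_nonneg_Reals_iff by blast
  ultimately show ?thesis
    unfolding T_def[symmetric] by (simp add: cmod_def power2_eq_square)
qed

lemma spatial_tensorD:
  assumes "spatial_tensor t"
  shows "clinear (t a)" "clinear (\<lambda>a. t a b)" "t 1 1 = 1" "t a b * t a' b' = t (a * a') (b * b')"
    "star (t a b) = t (star a) (star b)" "closure (range (\<lambda>us. \<Sum>(a, b)\<leftarrow>us. t a b)) = UNIV"
    "isLub UNIV (spatial_values us) (norm (\<Sum>(a, b)\<leftarrow>us. t a b))"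
  using assms unfolding spatial_tensor_def by blast+

text \<open>The unit vector 1 \<otimes> 1 competes in the supremum defining the spatial norm, so
  that norm dominates the length of u applied to it, and this dominates the value at u.\<close>

lemma ten_functional_le_norm:
  assumes "spatial_tensor t" "state \<phi>" "state \<psi>"
  shows "cmod (ten_functional \<phi> \<psi> us) \<le> norm (\<Sum>(a, b)\<leftarrow>us. t a b)"
proof -
  have "ten_mult us [(1, 1)] = us"
    by (induction us) (auto simp: ten_mult_def)
  moreover have "Re (ten_functional \<phi> \<psi> (ten_mult (ten_star [(1, 1)]) [(1, 1)])) \<le> 1"
    using assms(2,3) by (simp add: ten_functional_mult_star state_def)
  ultimately have "sqrt (Re (ten_functional \<phi> \<psi> (ten_mult (ten_star us) us))) \<in> spatial_values us"
    unfolding spatial_values_def using assms(2,3) by force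
  then have "sqrt (Re (ten_functional \<phi> \<psi> (ten_mult (ten_star us) us))) \<le> norm (\<Sum>(a, b)\<leftarrow>us. t a b)"
    using spatial_tensorD(7)[OF assms(1)] by (auto simp: isLub_def isUb_def setle_def leastP_def)
  moreover have "cmod (ten_functional \<phi> \<psi> us) \<le> sqrt (Re (ten_functional \<phi> \<psi> (ten_mult (ten_star us) us)))"
    using assms(2,3) by (intro real_le_rsqrt ten_functional_cauchy_schwarz state_positive) (auto simp: state_def)
  ultimately show ?thesis by simp
qed

text \<open>The extension lemma is used with lists of pairs as indices: that the value does not
  depend on the list representing a tensor is then a consequence of the norm bound. Density of the
  algebraic tensors gives uniqueness, which resolves the description.\<close>

lemma tensor_functional:
  assumes t: "spatial_tensor t" and st: "state \<phi>" "state \<psi>"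
  shows "clinear (tensor_functional t \<phi> \<psi>)" "continuous_on UNIV (tensor_functional t \<phi> \<psi>)"
    "tensor_functional t \<phi> \<psi> (t a b) = \<phi> a * \<psi> b"
proof -
  let ?L = "\<lambda>us. \<Sum>(a, b)\<leftarrow>us. t a b"
  let ?P = "\<lambda>F. clinear F \<and> continuous_on UNIV F \<and> (\<forall>a b. F (t a b) = \<phi> a * \<psi> b)"
  have "\<exists>F. clinear F \<and> continuous_on UNIV F \<and> (\<forall>us. F (?L us) = ten_functional \<phi> \<psi> us)"
  proof (rule clinear_extension)
    fix us vs
    show "\<exists>ws. ?L ws = ?L us + ?L vs \<and>
        ten_functional \<phi> \<psi> ws = ten_functional \<phi> \<psi> us + ten_functional \<phi> \<psi> vs"
      by (rule exI[of _ "us @ vs"]) (simp add: ten_functional_def)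
  next
    fix c us
    have "?L (map (\<lambda>(a, b). (c *\<^sub>C a, b)) us) = c *\<^sub>C ?L us \<and>
        ten_functional \<phi> \<psi> (map (\<lambda>(a, b). (c *\<^sub>C a, b)) us) = c * ten_functional \<phi> \<psi> us"
      using clinear_scaleC[OF spatial_tensorD(2)[OF t]] st(1)
      by (induction us)
         (auto simp: ten_functional_def scaleC_add_right distrib_left clinear_simps state_def scaleC_complex_def)
    then show "\<exists>ws. ?L ws = c *\<^sub>C ?L us \<and> ten_functional \<phi> \<psi> ws = c * ten_functional \<phi> \<psi> us"
      by blast
  qed (use spatial_tensorD(6)[OF t] ten_functional_le_norm[OF assms] in auto)
  then obtain F where F: "clinear F" "continuous_on UNIV F" "\<And>us. F (?L us) = ten_functional \<phi> \<psi> us"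
    by blast
  have "?P F"
    using F(1,2) F(3)[of "[(a, b)]" for a b] by (simp add: ten_functional_def)
  moreover have "G = F" if "?P G" for G
  proof (rule continuous_eq_of_dense[OF _ F(2) spatial_tensorD(6)[OF t]])
    fix us
    show "G (?L us) = F (?L us)"
      using that \<open>?P F\<close> by (induction us) (auto simp: clinear_simps)
  qed (use that in blast)
  ultimately have "?P (tensor_functional t \<phi> \<psi>)"
    unfolding tensor_functional_def by (rule theI)
  then show "clinear (tensor_functional t \<phi> \<psi>)" "continuous_on UNIV (tensor_functional t \<phi> \<psi>)"
    "tensor_functional t \<phi> \<psi> (t a b) = \<phi> a * \<psi> b"
    by blast+
qed

section \<open>Haar measure on closed subgroups of the circle\<close>

definition is_haar_measure :: "complex set \<Rightarrow> complex measure \<Rightarrow> bool"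
  where "is_haar_measure K \<mu> \<longleftrightarrow> sets \<mu> = sets (restrict_space borel K) \<and>
    emeasure \<mu> (space \<mu>) = 1 \<and> (\<forall>z\<in>K. distr \<mu> \<mu> (\<lambda>w. z * w) = \<mu>)"

lemma is_haar_measureD:
  assumes "is_haar_measure K \<mu>"
  shows "sets \<mu> = sets (restrict_space borel K)" "space \<mu> = K" "emeasure \<mu> K = 1"
    "z \<in> K \<Longrightarrow> distr \<mu> \<mu> (\<lambda>w. z * w) = \<mu>"
proof -
  show sets: "sets \<mu> = sets (restrict_space borel K)" and "z \<in> K \<Longrightarrow> distr \<mu> \<mu> (\<lambda>w. z * w) = \<mu>"
    using assms by (auto simp: is_haar_measure_def)
  show "space \<mu> = K"
    using sets_eq_imp_space_eq[OF sets] by (simp add: space_restrict_space)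
  then show "emeasure \<mu> K = 1"
    using assms by (simp add: is_haar_measure_def)
qed

lemma is_haar_measure_finite: "is_haar_measure K \<mu> \<Longrightarrow> finite_measure \<mu>"
  by (rule finite_measureI) (simp add: is_haar_measureD)

lemma is_haar_measure_measurable_mult:
  assumes "is_haar_measure K \<mu>" "z \<in> K" "\<And>w. w \<in> K \<Longrightarrow> z * w \<in> K"
  shows "(\<lambda>w. z * w) \<in> measurable \<mu> \<mu>"
proof -
  have "(\<lambda>w. z * w) \<in> measurable (restrict_space borel K) (restrict_space borel K)"
    by (rule measurable_restrict_space2)
       (auto simp: space_restrict_space assms intro!: measurable_restrict_space1)
  then show ?thesis
    unfolding measurable_cong_sets[OF is_haar_measureD(1)[OF assms(1)] is_haar_measureD(1)[OF assms(1)]] .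
qed

text \<open>Both measures of \<open>A\<close> equal the double integral of
  \<open>indicator A (z * w)\<close>: invariance collapses the inner integral in either order, and
  the orders agree by Fubini. Commutativity lets the same invariance serve for both factors.\<close>

lemma is_haar_measure_unique:
  assumes \<mu>: "is_haar_measure K \<mu>" and \<nu>: "is_haar_measure K \<nu>"
    and mult: "\<And>z w. z \<in> K \<Longrightarrow> w \<in> K \<Longrightarrow> z * w \<in> K"
  shows "\<mu> = \<nu>"
proof (rule measure_eqI)
  show "sets \<mu> = sets \<nu>"
    using \<mu> \<nu> by (simp add: is_haar_measureD)
next
  fix A assume A: "A \<in> sets \<mu>"
  interpret \<mu>: finite_measure \<mu> using \<mu> by (rule is_haar_measure_finite)
  interpret \<nu>: finite_measure \<nu> using \<nu> by (rule is_haar_measure_finite)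
  interpret pair_sigma_finite \<mu> \<nu> ..
  have A': "A \<in> sets \<nu>"
    using A \<mu> \<nu> by (simp add: is_haar_measureD)
  have meas: "(\<lambda>(z, w). z * w) \<in> measurable (\<mu> \<Otimes>\<^sub>M \<nu>) \<mu>"
  proof -
    have "(\<lambda>p. fst p * snd p) \<in> measurable (\<mu> \<Otimes>\<^sub>M \<nu>) borel"
    proof (rule borel_measurable_times)
      have id: "(\<lambda>x. x) \<in> measurable M borel" if "sets M = sets (restrict_space borel K)" for M :: "complex measure"
        unfolding measurable_cong_sets[OF that HOL.refl] by (rule measurable_restrict_space1) simp
      show "fst \<in> measurable (\<mu> \<Otimes>\<^sub>M \<nu>) borel" "snd \<in> measurable (\<mu> \<Otimes>\<^sub>M \<nu>) borel"
        using measurable_compose[OF measurable_fst id] measurable_compose[OF measurable_snd id]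
          is_haar_measureD(1)[OF \<mu>] is_haar_measureD(1)[OF \<nu>] by auto
    qed
    then have "(\<lambda>p. fst p * snd p) \<in> measurable (\<mu> \<Otimes>\<^sub>M \<nu>) (restrict_space borel K)"
      by (rule measurable_restrict_space2[rotated])
         (auto simp: space_pair_measure is_haar_measureD(2)[OF \<mu>] is_haar_measureD(2)[OF \<nu>] mult)
    then show ?thesis
      by (simp add: case_prod_unfold measurable_cong_sets[OF HOL.refl is_haar_measureD(1)[OF \<mu>]])
  qed
  have ind: "(\<lambda>p. indicator A (fst p * snd p) :: ennreal) \<in> borel_measurable (\<mu> \<Otimes>\<^sub>M \<nu>)"
    using measurable_compose[OF meas borel_measurable_indicator[OF A]] by (simp add: case_prod_unfold)
  have row: "emeasure M A = (\<integral>\<^sup>+ w. indicator A (z * w) \<partial>M)"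
    if M: "is_haar_measure K M" and z: "z \<in> K" for M z
  proof -
    have AM: "A \<in> sets M"
      using A by (simp add: is_haar_measureD(1)[OF M] is_haar_measureD(1)[OF \<mu>])
    have "emeasure M A = (\<integral>\<^sup>+ w. indicator A w \<partial>(distr M M (\<lambda>w. z * w)))"
      using AM by (simp add: is_haar_measureD(4)[OF M z])
    also have "\<dots> = (\<integral>\<^sup>+ w. indicator A (z * w) \<partial>M)"
      by (rule nn_integral_distr[OF is_haar_measure_measurable_mult[OF M z mult[OF z]]])
         (assumption, rule borel_measurable_indicator, simp add: AM)
    finally show ?thesis .
  qed
  have "emeasure \<mu> A = (\<integral>\<^sup>+ w. emeasure \<mu> A \<partial>\<nu>)"
    using is_haar_measureD(2,3)[OF \<nu>] by simp
  also have "\<dots> = (\<integral>\<^sup>+ w. \<integral>\<^sup>+ z. indicator A (z * w) \<partial>\<mu> \<partial>\<nu>)"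
  proof (rule nn_integral_cong)
    fix w assume "w \<in> space \<nu>"
    then show "emeasure \<mu> A = (\<integral>\<^sup>+ z. indicator A (z * w) \<partial>\<mu>)"
      unfolding mult.commute[of _ w] by (intro row[OF \<mu>]) (simp add: is_haar_measureD(2)[OF \<nu>])
  qed
  also have "\<dots> = (\<integral>\<^sup>+ z. \<integral>\<^sup>+ w. indicator A (z * w) \<partial>\<nu> \<partial>\<mu>)"
    using Fubini'[of "\<lambda>z w. indicator A (z * w)"] ind by (simp add: case_prod_unfold)
  also have "\<dots> = (\<integral>\<^sup>+ z. emeasure \<nu> A \<partial>\<mu>)"
    by (rule nn_integral_cong) (simp add: row[OF \<nu>] is_haar_measureD(2)[OF \<mu>])
  also have "\<dots> = emeasure \<nu> A"
    using is_haar_measureD(2,3)[OF \<mu>] by simp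
  finally show "emeasure \<mu> A = emeasure \<nu> A" .
qed

lemma is_haar_measure_haar_measure:
  assumes "is_haar_measure K \<mu>" "\<And>z w. z \<in> K \<Longrightarrow> w \<in> K \<Longrightarrow> z * w \<in> K"
  shows "is_haar_measure K (haar_measure K)"
proof -
  have "haar_measure K = (THE \<mu>. is_haar_measure K \<mu>)"
    by (simp add: haar_measure_def is_haar_measure_def)
  then show ?thesis
    using theI[of "is_haar_measure K" \<mu>] assms is_haar_measure_unique by metis
qed

text \<open>Multiplication by a nonzero element is injective, hence permutes the finite set
  \<open>K\<close>, so counting is invariant. All subsets of \<open>K\<close> are closed, so its
  Borel sets are all its subsets.\<close>

lemma is_haar_measure_finite_group:
  assumes "finite K" "K \<noteq> {}" "0 \<notin> K" and mult: "\<And>z w. z \<in> K \<Longrightarrow> w \<in> K \<Longrightarrow> z * w \<in> K"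
  shows "is_haar_measure K (uniform_count_measure K)"
proof -
  have sets: "sets (restrict_space borel K) = Pow K"
  proof -
    have "A \<in> sets borel" if "A \<subseteq> K" for A
      using assms(1) that by (meson finite_imp_closed finite_subset borel_closed)
    then show ?thesis
      by (auto simp: sets_restrict_space image_iff)
  qed
  have inv: "distr (uniform_count_measure K) (uniform_count_measure K) (\<lambda>w. z * w) = uniform_count_measure K"
    if z: "z \<in> K" for z
  proof (rule measure_eqI)
    fix A assume "A \<in> sets (distr (uniform_count_measure K) (uniform_count_measure K) (\<lambda>w. z * w))"
    then have A: "A \<subseteq> K" by (simp add: sets_uniform_count_measure)
    have bij: "bij_betw (\<lambda>w. z * w) K K"
    proof -
      have "inj_on (\<lambda>w. z * w) K"
        using z assms(3) by (auto simp: inj_on_def)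
      moreover from this have "(\<lambda>w. z * w) ` K = K"
        using assms(1) mult z by (intro endo_inj_surj) auto
      ultimately show ?thesis
        by (simp add: bij_betw_def)
    qed
    have "card ((\<lambda>w. z * w) -` A \<inter> K) = card A"
    proof -
      have "(\<lambda>w. z * w) ` ((\<lambda>w. z * w) -` A \<inter> K) = A"
      proof
        show "A \<subseteq> (\<lambda>w. z * w) ` ((\<lambda>w. z * w) -` A \<inter> K)"
        proof
          fix x assume "x \<in> A"
          then have "x \<in> (\<lambda>w. z * w) ` K"
            using bij A by (auto simp: bij_betw_def)
          with \<open>x \<in> A\<close> show "x \<in> (\<lambda>w. z * w) ` ((\<lambda>w. z * w) -` A \<inter> K)"
            by blast
        qed
      qed auto
      moreover have "inj_on (\<lambda>w. z * w) ((\<lambda>w. z * w) -` A \<inter> K)"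
        using bij by (auto simp: bij_betw_def inj_on_def)
      ultimately show ?thesis
        by (metis card_image)
    qed
    then show "emeasure (distr (uniform_count_measure K) (uniform_count_measure K) (\<lambda>w. z * w)) A =
        emeasure (uniform_count_measure K) A"
      using A assms(1)
      by (subst emeasure_distr)
         (auto simp: measurable_def sets_uniform_count_measure space_uniform_count_measure mult z
           emeasure_uniform_count_measure)
  qed simp
  show ?thesis
    unfolding is_haar_measure_def
    using inv assms(1,2)
    by (auto simp: sets sets_uniform_count_measure space_uniform_count_measure
        emeasure_uniform_count_measure card_gt_0_iff)
qed

text \<open>The image of Lebesgue measure on [0, 1) under t \<mapsto> cis (2 pi t). Rotations become
  translations modulo 1, so invariance follows from translation invariance and periodicity.\<close>

lemma is_haar_measure_circle: "\<exists>\<mu>. is_haar_measure (sphere 0 1) \<mu>"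
proof -
  define e where "e t = cis (2 * pi * t)" for t :: real
  let ?S = "restrict_space borel (sphere 0 1) :: complex measure"
  define U where "U = restrict_space lborel {0..<1::real}"
  define \<mu> where "\<mu> = distr U ?S e"
  have e_borel: "e \<in> measurable borel ?S"
    by (rule measurable_restrict_space2)
       (auto simp: e_def intro!: borel_measurable_continuous_onI continuous_intros)
  have e_U: "e \<in> measurable U ?S"
    unfolding U_def using e_borel by (simp add: measurable_restrict_space1)
  have e_add: "e (s + t) = e s * e t" for s t
    by (simp add: e_def cis_mult distrib_left)
  have e_per: "e (t + 1) = e t" for t
    by (simp add: e_add) (simp add: e_def)
  have em: "emeasure \<mu> A = emeasure lborel (e -` A \<inter> {0..<1})" if "A \<in> sets ?S" for A
  proof -
    have "emeasure \<mu> A = emeasure U (e -` A \<inter> {0..<1})"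
      using that e_U by (simp add: \<mu>_def emeasure_distr U_def space_restrict_space)
    also have "\<dots> = emeasure lborel (e -` A \<inter> {0..<1})"
      unfolding U_def by (rule emeasure_restrict_space) auto
    finally show ?thesis .
  qed
  have pre: "e -` A \<in> sets borel" if "A \<in> sets ?S" for A
    using measurable_sets[OF e_borel that] by simp
  have shift: "emeasure lborel {t \<in> B. c + t \<in> C} = emeasure lborel {t \<in> C. t - c \<in> B}"
    if "B \<in> sets borel" "C \<in> sets borel" for B C and c :: real
  proof -
    have *: "{t \<in> C. t - c \<in> B} \<in> sets borel"
      using that by measurable
    have "emeasure lborel {t \<in> C. t - c \<in> B} = emeasure (distr lborel borel ((+) c)) {t \<in> C. t - c \<in> B}"
      by (simp add: lborel_distr_plus)
    also have "\<dots> = emeasure lborel ((+) c -` {t \<in> C. t - c \<in> B})"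
      by (subst emeasure_distr) (use * in auto)
    also have "(+) c -` {t \<in> C. t - c \<in> B} = {t \<in> B. c + t \<in> C}"
      by auto
    finally show ?thesis by simp
  qed
  have inv: "emeasure lborel {t \<in> {0..<1}. e (s + t) \<in> A} = emeasure lborel (e -` A \<inter> {0..<1})"
    if s: "0 \<le> s" "s < 1" and A: "A \<in> sets ?S" for s A
  proof -
    let ?B = "e -` A"
    note [measurable] = pre[OF A]
    have B: "t + 1 \<in> ?B \<longleftrightarrow> t \<in> ?B" for t
      by (simp add: e_per)
    have "emeasure lborel {t \<in> {0..<1}. e (s + t) \<in> A} = emeasure lborel {t \<in> {0..<1}. s + t \<in> ?B}"
      by simp
    also have "\<dots> = emeasure lborel {t \<in> ?B. t - s \<in> {0..<1}}"
      by (rule shift) (use pre[OF A] in auto)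
    \<comment> \<open>The translated interval [s, 1 + s) is cut at 1; the part beyond 1 is moved
      back by one period to [0, s).\<close>
    also have "{t \<in> ?B. t - s \<in> {0..<1}} = (?B \<inter> {s..<1}) \<union> (?B \<inter> {1..<1 + s})"
      using s by auto
    also have "emeasure lborel \<dots> = emeasure lborel (?B \<inter> {s..<1}) + emeasure lborel (?B \<inter> {1..<1 + s})"
      by (rule plus_emeasure[symmetric]) (use pre[OF A] in auto)
    also have "emeasure lborel (?B \<inter> {1..<1 + s}) = emeasure lborel {t \<in> {1..<1 + s}. -1 + t \<in> ?B}"
    proof -
      have "?B \<inter> {1..<1 + s} = {t \<in> {1..<1 + s}. -1 + t \<in> ?B}"
        using B[of "_ - 1"] by auto
      then show ?thesis by simp
    qed
    also have "\<dots> = emeasure lborel {t \<in> ?B. t - -1 \<in> {1..<1 + s}}"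
      by (rule shift) (use pre[OF A] in auto)
    also have "{t \<in> ?B. t - -1 \<in> {1..<1 + s}} = ?B \<inter> {0..<s}"
      by auto
    also have "emeasure lborel (?B \<inter> {s..<1}) + emeasure lborel (?B \<inter> {0..<s}) =
        emeasure lborel ((?B \<inter> {s..<1}) \<union> (?B \<inter> {0..<s}))"
      by (rule plus_emeasure) (use pre[OF A] in auto)
    also have "(?B \<inter> {s..<1}) \<union> (?B \<inter> {0..<s}) = ?B \<inter> {0..<1}"
      using s by auto
    finally show ?thesis .
  qed
  have "is_haar_measure (sphere 0 1) \<mu>"
    unfolding is_haar_measure_def
  proof (intro conjI ballI)
    show sets: "sets \<mu> = sets ?S"
      by (simp add: \<mu>_def)
    have "space \<mu> = sphere 0 1"
      by (simp add: \<mu>_def space_restrict_space)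
    then show "emeasure \<mu> (space \<mu>) = 1"
      using em[of "sphere 0 1"] sets.top[of ?S] by (simp add: space_restrict_space e_def vimage_def)
  next
    fix z :: complex assume z: "z \<in> sphere 0 1"
    obtain s where s: "0 \<le> s" "s < 1" "z = e s"
    proof -
      have "cis (2 * pi * (Arg2pi z / (2 * pi))) = z"
        using Arg2pi_eq[of z] z by (simp add: cis_conv_exp)
      then show ?thesis
        using that[of "Arg2pi z / (2 * pi)"] Arg2pi_ge_0[of z] Arg2pi_lt_2pi[of z] by (simp add: e_def)
    qed
    have meas: "(\<lambda>w. z * w) \<in> measurable \<mu> \<mu>"
    proof -
      have "(\<lambda>w. z * w) \<in> measurable ?S ?S"
        by (rule measurable_restrict_space2)
           (use z in \<open>auto simp: space_restrict_space norm_mult intro!: measurable_restrict_space1\<close>)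
      then show ?thesis
        by (simp add: \<mu>_def)
    qed
    show "distr \<mu> \<mu> (\<lambda>w. z * w) = \<mu>"
    proof (rule measure_eqI)
      fix A assume "A \<in> sets (distr \<mu> \<mu> (\<lambda>w. z * w))"
      then have A: "A \<in> sets \<mu>" by simp
      let ?A = "(\<lambda>w. z * w) -` A \<inter> space \<mu>"
      have "emeasure (distr \<mu> \<mu> (\<lambda>w. z * w)) A = emeasure \<mu> ?A"
        using meas A by (rule emeasure_distr)
      also have "\<dots> = emeasure lborel (e -` ?A \<inter> {0..<1})"
        using measurable_sets[OF meas A] by (intro em) (simp add: \<mu>_def)
      also have "e -` ?A \<inter> {0..<1} = {t \<in> {0..<1}. e (s + t) \<in> A}"
        by (auto simp: \<mu>_def space_restrict_space e_add s(3)) (auto simp: e_def)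
      also have "emeasure lborel \<dots> = emeasure lborel (e -` A \<inter> {0..<1})"
        using A by (intro inv s) (simp add: \<mu>_def)
      also have "\<dots> = emeasure \<mu> A"
        using A by (intro em[symmetric]) (simp add: \<mu>_def)
      finally show "emeasure (distr \<mu> \<mu> (\<lambda>w. z * w)) A = emeasure \<mu> A" .
    qed simp
  qed
  then show ?thesis ..
qed

section \<open>The Haar states\<close>

text \<open>Neumann series: if |f x| exceeded the norm of x, then y = x / f x would have norm below
  1 and f y = 1. The geometric sum w satisfies w = 1 + y w, so f w = 1 + f w, which is absurd. For
  the evaluations of \<open>j\<close> this gives a bound uniform in the point, hence
  integrability.\<close>

lemma star_hom_contractive:
  fixes f :: "'a::cstar_algebra \<Rightarrow> complex"
  assumes "star_hom f"
  shows "cmod (f x) \<le> norm x"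
proof (rule ccontr)
  assume "\<not> ?thesis"
  then have less: "norm x < cmod (f x)" by simp
  then have fx: "f x \<noteq> 0" using norm_ge_zero[of x] by auto
  define y where "y = inverse (f x) *\<^sub>C x"
  have "norm y < 1"
    unfolding y_def norm_scaleC norm_inverse using less fx by (simp add: field_simps)
  then have "summable (\<lambda>n. norm y ^ n)"
    by (simp add: summable_geometric)
  then have sm: "summable (\<lambda>n. y ^ n)"
    by (rule summable_comparison_test[rotated]) (auto intro: norm_power_ineq)
  define w where "w = suminf (\<lambda>n. y ^ n)"
  have "w = 1 + y * w"
    using suminf_split_head[OF sm] suminf_mult[OF sm, of y] by (simp add: w_def)
  then have "f w = 1 + f y * f w"
    by (metis star_homD clinear_add assms)
  moreover have "f y = 1"
    using fx assms by (simp add: y_def clinear_simps star_homD scaleC_complex_def)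
  ultimately show False by simp
qed

lemma star_hom_state:
  fixes f :: "'a::cstar_algebra \<Rightarrow> complex"
  assumes "star_hom f" "continuous_on UNIV f"
  shows "state f"
  using assms star_hom_positive[OF assms(1)]
  by (simp add: state_def positive_functional_def star_homD)

lemma star_hom_pol_monomial:
  fixes f :: "pol \<Rightarrow> complex"
  assumes "star_hom f" "f pol_gamma = 0"
  shows "f (pol_monomial r k s) = (if k = 0 then cnj (f pol_alpha) ^ r * f pol_alpha ^ s else 0)"
  using assms(2)
  by (auto simp: pol_monomial_def pol_gamma_powi_def star_homD[OF assms(1)] star_hom_power[OF assms(1)]
      star_complex_def)

context
  fixes \<iota> :: "pol \<Rightarrow> 'a::cstar_algebra" and j :: "'a \<Rightarrow> complex \<Rightarrow> complex" and K :: "complex set"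
  assumes \<iota>: "star_hom \<iota>" and j: "su0_to_circle \<iota> j"
    and haar: "is_haar_measure K (haar_measure K)" and K: "K \<subseteq> sphere 0 1"
    and mult: "\<And>z w. z \<in> K \<Longrightarrow> w \<in> K \<Longrightarrow> z * w \<in> K"
begin

lemma j_star_hom: "z \<in> K \<Longrightarrow> star_hom (\<lambda>x. j x z)"
  using j K by (auto simp: su0_to_circle_def)

lemma haar_measurable: "continuous_on K h \<Longrightarrow> h \<in> borel_measurable (haar_measure K)"
  for h :: "complex \<Rightarrow> complex"
  unfolding measurable_cong_sets[OF is_haar_measureD(1)[OF haar] HOL.refl]
  by (rule borel_measurable_continuous_on_restrict)

lemma haar_integrable:
  fixes h :: "complex \<Rightarrow> complex"
  assumes "continuous_on K h" "\<And>z. z \<in> K \<Longrightarrow> cmod (h z) \<le> B"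
  shows "integrable (haar_measure K) h"
  using is_haar_measure_finite[OF haar] haar_measurable[OF assms(1)] assms(2)
  by (intro finite_measure.integrable_const_bound[of _ _ B])
     (auto simp: is_haar_measureD(2)[OF haar] intro!: AE_I2)

lemma haar_integral_const: "(\<integral>z. c \<partial>haar_measure K) = (c :: complex)"
  using is_haar_measureD(2,3)[OF haar] by (simp add: measure_def)

lemma j_integrable: "integrable (haar_measure K) (j x)"
proof (rule haar_integrable)
  show "continuous_on K (j x)"
    using j K by (auto simp: su0_to_circle_def intro: continuous_on_subset)
  show "cmod (j x z) \<le> norm x" if "z \<in> K" for z
    using star_hom_contractive[OF j_star_hom[OF that]] .
qed

lemma haar_state_cong:
  assumes "\<And>z. z \<in> K \<Longrightarrow> j x z = h z"
  shows "haar_state j K x = (\<integral>z. h z \<partial>haar_measure K)"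
  unfolding haar_state_def
  by (rule Bochner_Integration.integral_cong) (auto simp: assms is_haar_measureD(2)[OF haar])

lemma state_haar_state: "state (haar_state j K)"
proof -
  have lin: "clinear (haar_state j K)"
    unfolding clinear_def
  proof (intro conjI allI)
    fix x y c
    have "haar_state j K (x + y) = (\<integral>z. j x z + j y z \<partial>haar_measure K)"
      by (rule haar_state_cong) (simp add: clinear_add[OF star_homD(1)[OF j_star_hom]])
    then show "haar_state j K (x + y) = haar_state j K x + haar_state j K y"
      by (simp add: haar_state_def Bochner_Integration.integral_add j_integrable)
    have "haar_state j K (c *\<^sub>C x) = (\<integral>z. c * j x z \<partial>haar_measure K)"
      by (rule haar_state_cong) (simp add: clinear_scaleC[OF star_homD(1)[OF j_star_hom]] scaleC_complex_def)
    then show "haar_state j K (c *\<^sub>C x) = c *\<^sub>C haar_state j K x"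
      by (simp add: haar_state_def scaleC_complex_def)
  qed
  have "cmod (haar_state j K x) \<le> 1 * norm x" for x
  proof -
    have "cmod (haar_state j K x) \<le> (\<integral>z. cmod (j x z) \<partial>haar_measure K)"
      unfolding haar_state_def by (rule integral_norm_bound)
    also have "\<dots> \<le> (\<integral>z. norm x \<partial>haar_measure K)"
    proof (rule integral_mono)
      show "integrable (haar_measure K) (\<lambda>z. norm x)"
        using is_haar_measure_finite[OF haar] by (simp add: finite_measure.integrable_const)
      show "cmod (j x z) \<le> norm x" if "z \<in> space (haar_measure K)" for z
        using that star_hom_contractive[OF j_star_hom] by (simp add: is_haar_measureD(2)[OF haar])
    qed (simp add: j_integrable)
    also have "\<dots> = norm x"
      using is_haar_measureD(2,3)[OF haar] by (simp add: measure_def)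
    finally show ?thesis by simp
  qed
  then have cont: "continuous_on UNIV (haar_state j K)"
    using lin by (rule clinear_norm_bound_continuous[rotated])
  have pos: "haar_state j K (star x * x) \<in> \<real>\<^sub>\<ge>\<^sub>0" for x
  proof -
    have "haar_state j K (star x * x) = (\<integral>z. of_real ((cmod (j x z))\<^sup>2) \<partial>haar_measure K)"
      unfolding complex_norm_square
      by (rule haar_state_cong) (simp add: star_homD[OF j_star_hom] star_complex_def mult.commute)
    also have "\<dots> = of_real (\<integral>z. (cmod (j x z))\<^sup>2 \<partial>haar_measure K)"
      by (rule integral_complex_of_real)
    finally show ?thesis
      by (simp del: of_real_power)
  qed
  have "haar_state j K 1 = 1"
    using haar_state_cong[of 1 "\<lambda>z. 1"] haar_integral_const by (simp add: star_homD[OF j_star_hom])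
  then show ?thesis
    using lin cont pos by (simp add: state_def)
qed

text \<open>By invariance, a nontrivial character of the group has integral 0.\<close>

lemma haar_state_monomial:
  "haar_state j K (\<iota> (pol_monomial r k s)) = (if k = 0 \<and> (\<forall>z\<in>K. z ^ r = z ^ s) then 1 else 0)"
proof (cases "k = 0")
  case False
  have "haar_state j K (\<iota> (pol_monomial r k s)) = (\<integral>z. 0 \<partial>haar_measure K)"
  proof (rule haar_state_cong)
    fix z assume z: "z \<in> K"
    show "j (\<iota> (pol_monomial r k s)) z = 0"
      using star_hom_pol_monomial[OF star_hom_comp[OF j_star_hom[OF z] \<iota>], of r k s] False z j K
      by (auto simp: su0_to_circle_def)
  qed
  then show ?thesis using False by simp
next
  case True
  define h where "h z = cnj z ^ r * z ^ s" for z :: complex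
  have eq: "haar_state j K (\<iota> (pol_monomial r k s)) = (\<integral>z. h z \<partial>haar_measure K)"
  proof (rule haar_state_cong)
    fix z assume z: "z \<in> K"
    have "j (\<iota> pol_alpha) z = z" "j (\<iota> pol_gamma) z = 0"
      using z j K by (auto simp: su0_to_circle_def)
    then show "j (\<iota> (pol_monomial r k s)) z = h z"
      using star_hom_pol_monomial[OF star_hom_comp[OF j_star_hom[OF z] \<iota>], of r k s] True
      by (simp add: h_def)
  qed
  \<comment> \<open>On the circle the conjugate is the inverse, so \<open>h\<close> is the character
    z^(s - r).\<close>
  have h1: "h z = 1 \<longleftrightarrow> z ^ r = z ^ s" if "z \<in> K" for z
  proof -
    have "cmod z = 1" using that K by auto
    then have "cnj z ^ r * z ^ r = 1"
      by (simp add: complex_norm_square[symmetric] mult.commute flip: power_mult_distrib)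
    then show ?thesis
      unfolding h_def by (metis mult_cancel_left mult_zero_left zero_neq_one)
  qed
  show ?thesis
  proof (cases "\<forall>z\<in>K. z ^ r = z ^ s")
    case all: True
    have "(\<integral>z. h z \<partial>haar_measure K) = (\<integral>z. 1 \<partial>haar_measure K)"
      by (rule Bochner_Integration.integral_cong) (use h1 all in \<open>auto simp: is_haar_measureD(2)[OF haar]\<close>)
    then show ?thesis
      using eq True all haar_integral_const[of 1] by simp
  next
    case False
    then obtain u where u: "u \<in> K" "u ^ r \<noteq> u ^ s" by blast
    have "continuous_on K h"
      unfolding h_def by (intro continuous_intros)
    then have meas: "h \<in> borel_measurable (haar_measure K)"
      by (rule haar_measurable)
    have "(\<integral>z. h z \<partial>haar_measure K) = (\<integral>z. h z \<partial>(distr (haar_measure K) (haar_measure K) (\<lambda>w. u * w)))"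
      by (simp add: is_haar_measureD(4)[OF haar u(1)])
    also have "\<dots> = (\<integral>z. h (u * z) \<partial>haar_measure K)"
      by (rule integral_distr[OF is_haar_measure_measurable_mult[OF haar u(1) mult[OF u(1)]] meas])
    also have "\<dots> = h u * (\<integral>z. h z \<partial>haar_measure K)"
      by (simp add: h_def power_mult_distrib mult_ac flip: integral_mult_right_zero)
    finally have "(\<integral>z. h z \<partial>haar_measure K) = 0"
      using h1[OF u(1)] u(2) by simp
    then show ?thesis
      using eq False by simp
  qed
qed

end

section \<open>Coinciding characters on the circle and on the roots of unity\<close>

lemma power_eq_on_circle: "(\<forall>z\<in>sphere 0 1. (z :: complex) ^ r = z ^ s) \<longleftrightarrow> r = s"
proof
  have less: "\<exists>z\<in>sphere 0 1. (z :: complex) ^ r \<noteq> z ^ s" if "r < s" for r s :: nat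
  proof
    define d where "d = s - r"
    have d: "s = r + d" "d > 0"
      using that by (simp_all add: d_def)
    \<comment> \<open>A point of angle pi / d has d-th power -1, which separates the exponents r and
      r + d.\<close>
    have "cis (pi / d) ^ d = -1"
      using d(2) by (simp add: Complex.DeMoivre)
    then show "cis (pi / d) ^ r \<noteq> cis (pi / d) ^ s"
      by (simp add: d(1) power_add)
  qed simp
  assume "\<forall>z\<in>sphere 0 1. (z :: complex) ^ r = z ^ s"
  then show "r = s"
    using less[of r s] less[of s r] by (metis linorder_neqE_nat)
qed simp

lemma power_eq_on_roots_of_unity:
  assumes "n > 0"
  shows "(\<forall>z\<in>{z :: complex. z ^ n = 1}. z ^ r = z ^ s) \<longleftrightarrow> r mod n = s mod n"
proof
  have le: "r mod n = s mod n" if "r \<le> s" "\<forall>z\<in>{z :: complex. z ^ n = 1}. z ^ r = z ^ s" for r s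
  proof -
    \<comment> \<open>A primitive n-th root of unity: its powers are 1 only at multiples of
      n.\<close>
    define z where "z = exp (2 * of_real pi * \<i> * of_nat 1 / of_nat n)"
    have "z ^ n = 1"
      using complex_root_unity[of n 1] assms by (simp add: z_def)
    then have "z ^ r = z ^ (r + (s - r))"
      using that by simp
    then have "z ^ r = z ^ r * z ^ (s - r)"
      by (simp only: power_add)
    moreover have "z \<noteq> 0"
      by (simp add: z_def)
    ultimately have "z ^ (s - r) = 1"
      by simp
    moreover have "z ^ (s - r) = exp (2 * of_real pi * \<i> * of_nat (s - r) / of_nat n)"
      by (simp add: z_def exp_of_nat_mult[symmetric] mult_ac)
    ultimately have "n dvd s - r"
      using complex_root_unity_eq_1[of n "s - r"] assms by simp
    then show ?thesis
      using that(1) by (metis mod_eq_dvd_iff_nat)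
  qed
  assume "\<forall>z\<in>{z :: complex. z ^ n = 1}. z ^ r = z ^ s"
  then show "r mod n = s mod n"
    using le[of r s] le[of s r] by (metis nat_le_linear)
next
  assume *: "r mod n = s mod n"
  have red: "z ^ m = z ^ (m mod n)" if "z ^ n = 1" for z :: complex and m
  proof -
    have "z ^ m = z ^ (n * (m div n) + m mod n)"
      by simp
    also have "\<dots> = z ^ (m mod n)"
      unfolding power_add power_mult that by simp
    finally show ?thesis .
  qed
  show "\<forall>z\<in>{z :: complex. z ^ n = 1}. z ^ r = z ^ s"
    using red[of _ r] red[of _ s] unfolding * by simp
qed

lemma is_haar_measure_circle_haar: "is_haar_measure (sphere 0 1) (haar_measure (sphere 0 1))"
proof -
  obtain \<mu> :: "complex measure" where "is_haar_measure (sphere 0 1) \<mu>"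
    using is_haar_measure_circle by blast
  then show ?thesis
    by (rule is_haar_measure_haar_measure) (simp add: norm_mult)
qed

lemma is_haar_measure_roots_of_unity:
  assumes "n > 0"
  shows "is_haar_measure {z. z ^ n = 1} (haar_measure {z. z ^ n = 1})"
proof (rule is_haar_measure_haar_measure[OF is_haar_measure_finite_group])
  show "finite {z :: complex. z ^ n = 1}"
    using assms by (simp add: finite_roots_unity)
  show "{z :: complex. z ^ n = 1} \<noteq> {}"
    by (auto intro: exI[of _ 1])
qed (use assms in \<open>auto simp: power_mult_distrib power_0_left\<close>)

text \<open>The index \<open>m = 0\<close> stands for \<open>\<infinity>\<close>, in accordance with \<open>r mod 0 = r\<close>.\<close>

lemma su0_phi:
  fixes \<iota> :: "pol \<Rightarrow> 'a::cstar_algebra" and m :: nat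
  assumes \<iota>: "star_hom \<iota>" and \<epsilon>: "su0_counit \<iota> \<epsilon>" and j: "su0_to_circle \<iota> j"
  defines "\<phi> \<equiv> su0_phi \<epsilon> j (if m = 0 then \<infinity> else enat m)"
  shows "state \<phi>"
    "\<phi> (\<iota> (pol_monomial r k s)) = (if k = 0 \<and> r mod m = s mod m then 1 else 0)"
proof -
  have "state \<phi> \<and> (\<forall>r k s. \<phi> (\<iota> (pol_monomial r k s)) = (if k = 0 \<and> r mod m = s mod m then 1 else 0))"
  proof -
    consider "m = 1" | "m = 0" | "m > 1" by linarith
    then show ?thesis
    proof cases
      case 1
      then have "\<phi> = \<epsilon>"
        by (simp add: \<phi>_def su0_phi_def one_enat_def)
      then show ?thesis
        using \<epsilon> 1 star_hom_state[of \<epsilon>] star_hom_pol_monomial[OF star_hom_comp[OF _ \<iota>], of \<epsilon>]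
        by (simp add: su0_counit_def)
    next
      case 2
      then have \<phi>: "\<phi> = haar_state j (sphere 0 1)"
        by (simp add: \<phi>_def su0_phi_def one_enat_def)
      have mult: "z * w \<in> sphere 0 1" if "z \<in> sphere 0 1" "w \<in> sphere 0 1" for z w :: complex
        using that by (simp add: norm_mult)
      from \<phi> show ?thesis
        using state_haar_state[OF \<iota> j is_haar_measure_circle_haar subset_refl mult]
          haar_state_monomial[OF \<iota> j is_haar_measure_circle_haar subset_refl mult] 2
        unfolding power_eq_on_circle by simp
    next
      case 3
      let ?K = "{z :: complex. z ^ m = 1}"
      have \<phi>: "\<phi> = haar_state j ?K"
        using 3 by (simp add: \<phi>_def su0_phi_def one_enat_def)
      have K: "?K \<subseteq> sphere 0 1"
        using 3 by (auto dest: power_eq_1_iff)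
      have mult: "z * w \<in> ?K" if "z \<in> ?K" "w \<in> ?K" for z w
        using that by (simp add: power_mult_distrib)
      have m: "m > 0" using 3 by simp
      show ?thesis
        unfolding \<phi>
        using state_haar_state[OF \<iota> j is_haar_measure_roots_of_unity[OF m] K mult]
          haar_state_monomial[OF \<iota> j is_haar_measure_roots_of_unity[OF m] K mult]
        unfolding power_eq_on_roots_of_unity[OF m] by blast
    qed
  qed
  then show "state \<phi>"
    "\<phi> (\<iota> (pol_monomial r k s)) = (if k = 0 \<and> r mod m = s mod m then 1 else 0)"
    by blast+
qed

section \<open>Convolution on monomials\<close>

lemma sum_eq_single:
  assumes "finite I" "k \<in> I" "\<And>i. i \<in> I \<Longrightarrow> i \<noteq> k \<Longrightarrow> f i = (0 :: 'a::comm_monoid_add)"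
  shows "sum f I = f k"
  using sum.mono_neutral_right[of I "{k}" f] assms by auto

context
  fixes \<iota> :: "pol \<Rightarrow> 'a::cstar_algebra"
    and t :: "'a \<Rightarrow> 'a \<Rightarrow> 'b::cstar_algebra"
    and \<Delta> :: "'a \<Rightarrow> 'b"
  assumes \<iota>: "star_hom \<iota>" and t: "spatial_tensor t" and \<Delta>: "su0_coproduct \<iota> t \<Delta>"
begin

lemma star_hom_coproduct: "star_hom (\<lambda>x. \<Delta> (\<iota> x))"
  using \<Delta> \<iota> by (simp add: su0_coproduct_def star_hom_comp)

lemma t_zero: "t 0 y = 0" "t x 0 = 0"
  using clinear_zero[OF spatial_tensorD(1)[OF t]] clinear_zero[OF spatial_tensorD(2)[OF t]] by auto

lemma t_power: "t x y ^ n = t (x ^ n) (y ^ n)"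
  by (induction n) (simp_all add: spatial_tensorD(3,4)[OF t])

text \<open>The two summands of \<Delta>(\<gamma>) do not commute, but \<gamma>\<alpha>* = 0 in the
  left leg kills every word in which \<gamma> \<otimes> \<alpha> stands before \<alpha>* \<otimes>
  \<gamma>. Of the 2^k words only k + 1 survive; in the induction, left multiplication by \<gamma>
  \<otimes> \<alpha> retains just the term i = 0.\<close>

lemma coproduct_gamma_power:
  "\<Delta> (\<iota> pol_gamma) ^ k =
    (\<Sum>i\<le>k. t (\<iota> (star pol_alpha ^ i * pol_gamma ^ (k - i))) (\<iota> (pol_gamma ^ i * pol_alpha ^ (k - i))))"
proof (induction k)
  case 0
  then show ?case
    using spatial_tensorD(3)[OF t] by (simp add: star_homD[OF \<iota>])
next
  case (Suc k)
  let ?x = "\<lambda>k i. star pol_alpha ^ i * pol_gamma ^ (k - i)"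
  let ?y = "\<lambda>k i. pol_gamma ^ i * pol_alpha ^ (k - i)"
  have \<Delta>\<gamma>: "\<Delta> (\<iota> pol_gamma) = t (\<iota> pol_gamma) (\<iota> pol_alpha) + t (\<iota> (star pol_alpha)) (\<iota> pol_gamma)"
    using \<Delta> by (simp add: su0_coproduct_def star_homD[OF \<iota>])
  have "\<Delta> (\<iota> pol_gamma) ^ Suc k =
      (\<Sum>i\<le>k. t (\<iota> (pol_gamma * ?x k i)) (\<iota> (pol_alpha * ?y k i)))
      + (\<Sum>i\<le>k. t (\<iota> (star pol_alpha * ?x k i)) (\<iota> (pol_gamma * ?y k i)))"
    using Suc unfolding power_Suc \<Delta>\<gamma>
    by (simp only: distrib_right sum_distrib_left sum.distrib spatial_tensorD(4)[OF t] star_homD(3)[OF \<iota>])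
  also have "(\<Sum>i\<le>k. t (\<iota> (pol_gamma * ?x k i)) (\<iota> (pol_alpha * ?y k i))) =
      t (\<iota> (pol_gamma * ?x k 0)) (\<iota> (pol_alpha * ?y k 0))"
  proof (rule sum_eq_single)
    fix i :: nat assume "i \<noteq> 0"
    then obtain l where "i = Suc l" by (cases i) auto
    then have "pol_gamma * ?x k i = 0"
      by (simp add: pol_star_relations flip: mult.assoc)
    then show "t (\<iota> (pol_gamma * ?x k i)) (\<iota> (pol_alpha * ?y k i)) = 0"
      by (simp add: clinear_zero[OF star_homD(1)[OF \<iota>]] t_zero)
  qed auto
  also have "t (\<iota> (pol_gamma * ?x k 0)) (\<iota> (pol_alpha * ?y k 0)) = t (\<iota> (?x (Suc k) 0)) (\<iota> (?y (Suc k) 0))"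
    by simp
  also have "(\<Sum>i\<le>k. t (\<iota> (star pol_alpha * ?x k i)) (\<iota> (pol_gamma * ?y k i))) =
      (\<Sum>i\<le>k. t (\<iota> (?x (Suc k) (Suc i))) (\<iota> (?y (Suc k) (Suc i))))"
    by (simp add: mult.assoc)
  also have "t (\<iota> (?x (Suc k) 0)) (\<iota> (?y (Suc k) 0)) + \<dots> =
      (\<Sum>i\<le>Suc k. t (\<iota> (?x (Suc k) i)) (\<iota> (?y (Suc k) i)))"
    by (rule sum.atMost_Suc_shift[symmetric])
  finally show ?case .
qed

lemma coproduct_monomial:
  "\<Delta> (\<iota> (pol_monomial r (int k) s)) =
    (\<Sum>i\<le>k. t (\<iota> (pol_monomial (r + i) (int (k - i)) s)) (\<iota> (pol_monomial r (int i) (k - i + s))))"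
proof -
  note hom = star_homD[OF \<iota>] star_hom_power[OF \<iota>]
  have \<Delta>\<alpha>: "\<Delta> (\<iota> pol_alpha) = t (\<iota> pol_alpha) (\<iota> pol_alpha)"
    using \<Delta> by (simp add: su0_coproduct_def)
  have "\<Delta> (\<iota> (pol_monomial r (int k) s)) =
      star (\<Delta> (\<iota> pol_alpha)) ^ r * \<Delta> (\<iota> pol_gamma) ^ k * \<Delta> (\<iota> pol_alpha) ^ s"
    unfolding pol_monomial_def pol_gamma_powi_nat
    by (simp only: star_homD[OF star_hom_coproduct] star_hom_power[OF star_hom_coproduct])
  also have "\<dots> = (\<Sum>i\<le>k.
      t (\<iota> (star pol_alpha ^ r * (star pol_alpha ^ i * pol_gamma ^ (k - i)) * pol_alpha ^ s))
        (\<iota> (star pol_alpha ^ r * (pol_gamma ^ i * pol_alpha ^ (k - i)) * pol_alpha ^ s)))"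
    unfolding \<Delta>\<alpha> coproduct_gamma_power spatial_tensorD(5)[OF t] t_power sum_distrib_left sum_distrib_right
      spatial_tensorD(4)[OF t]
    by (simp only: star_homD(3,4)[OF \<iota>] star_hom_power[OF \<iota>])
  also have "\<dots> = (\<Sum>i\<le>k. t (\<iota> (pol_monomial (r + i) (int (k - i)) s)) (\<iota> (pol_monomial r (int i) (k - i + s))))"
    unfolding pol_monomial_def pol_gamma_powi_nat power_add by (simp only: mult.assoc)
  finally show ?thesis .
qed

lemma convolution_monomial:
  assumes "state \<phi>"
  shows "tensor_functional t \<phi> \<phi> (\<Delta> (\<iota> (pol_monomial r (int k) s))) =
      (\<Sum>i\<le>k. \<phi> (\<iota> (pol_monomial (r + i) (int (k - i)) s)) * \<phi> (\<iota> (pol_monomial r (int i) (k - i + s))))"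
    and "tensor_functional t \<phi> \<phi> (\<Delta> (\<iota> (star (pol_monomial r (int k) s)))) =
      cnj (tensor_functional t \<phi> \<phi> (\<Delta> (\<iota> (pol_monomial r (int k) s))))"
proof -
  note F = tensor_functional[OF t assms assms]
  show *: "tensor_functional t \<phi> \<phi> (\<Delta> (\<iota> (pol_monomial r (int k) s))) =
      (\<Sum>i\<le>k. \<phi> (\<iota> (pol_monomial (r + i) (int (k - i)) s)) * \<phi> (\<iota> (pol_monomial r (int i) (k - i + s))))"
    by (simp only: coproduct_monomial clinear_sum[OF F(1)] F(3))
  show "tensor_functional t \<phi> \<phi> (\<Delta> (\<iota> (star (pol_monomial r (int k) s)))) =
      cnj (tensor_functional t \<phi> \<phi> (\<Delta> (\<iota> (pol_monomial r (int k) s))))"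
    unfolding * star_homD(4)[OF star_hom_coproduct] coproduct_monomial star_sum spatial_tensorD(5)[OF t]
      clinear_sum[OF F(1)] F(3)
    by (simp add: positive_functional_star[OF state_positive[OF assms]])
qed

text \<open>Exponents k \<ge> 0 suffice since the other monomials are adjoints of these, and states
  and their product functionals are compatible with adjoints there. Monomials span
  \<open>pol\<close>, and its image is dense.\<close>

lemma idempotent_state_iff:
  assumes dense: "closure (range \<iota>) = UNIV" and st: "state \<phi>"
  shows "idempotent_state t \<Delta> \<phi> \<longleftrightarrow> (\<forall>r k s. \<phi> (\<iota> (pol_monomial r (int k) s)) =
      (\<Sum>i\<le>k. \<phi> (\<iota> (pol_monomial (r + i) (int (k - i)) s)) * \<phi> (\<iota> (pol_monomial r (int i) (k - i + s)))))"
    (is "_ \<longleftrightarrow> ?R")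
proof
  assume "idempotent_state t \<Delta> \<phi>"
  then have "tensor_functional t \<phi> \<phi> (\<Delta> x) = \<phi> x" for x
    by (auto simp: idempotent_state_def fun_eq_iff)
  then show ?R
    using convolution_monomial(1)[OF st] by metis
next
  assume R: ?R
  note F = tensor_functional[OF t st st]
  have lin: "clinear (\<lambda>x. tensor_functional t \<phi> \<phi> (\<Delta> (\<iota> x)))" "clinear (\<lambda>x. \<phi> (\<iota> x))"
    by (rule clinear_comp[OF F(1) star_homD(1)[OF star_hom_coproduct]])
       (rule clinear_comp[OF positive_functionalD(1)[OF state_positive[OF st]] star_homD(1)[OF \<iota>]])
  have nat: "tensor_functional t \<phi> \<phi> (\<Delta> (\<iota> (pol_monomial r (int k) s))) = \<phi> (\<iota> (pol_monomial r (int k) s))"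
    for r k s
    using HOL.trans[OF convolution_monomial(1)[OF st] R[rule_format, symmetric]] .
  have mon: "tensor_functional t \<phi> \<phi> (\<Delta> (\<iota> (pol_monomial r k s))) = \<phi> (\<iota> (pol_monomial r k s))" for r k s
  proof (cases "k \<ge> 0")
    case True
    then show ?thesis
      using nat[of r "nat k" s] by simp
  next
    case False
    then have eq: "pol_monomial r k s = star (pol_monomial s (int (nat (- k))) r)"
      by (simp add: star_pol_monomial)
    show ?thesis
      unfolding eq convolution_monomial(2)[OF st] nat
      by (simp only: star_homD(4)[OF \<iota>] positive_functional_star[OF state_positive[OF st]])
  qed
  have "tensor_functional t \<phi> \<phi> \<circ> \<Delta> = \<phi>"
  proof (rule continuous_eq_of_dense[OF _ _ dense])
    show "continuous_on UNIV (tensor_functional t \<phi> \<phi> \<circ> \<Delta>)"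
      using \<Delta> by (intro continuous_on_compose continuous_on_subset[OF F(2)]) (auto simp: su0_coproduct_def)
    show "continuous_on UNIV \<phi>"
      using st by (simp add: state_def)
    show "(tensor_functional t \<phi> \<phi> \<circ> \<Delta>) (\<iota> x) = \<phi> (\<iota> x)" for x
      using clinear_eq_on_monomials[OF lin mon] by simp
  qed
  then show "idempotent_state t \<Delta> \<phi>"
    using st by (simp add: idempotent_state_def)
qed

text \<open>For k > 0 one of the exponents k - i and i is nonzero in every summand, so both sides
  vanish; for k = 0 the recursion says that the value is its own square. Covers \<phi>_n and
  \<psi>_n alike.\<close>

lemma idempotent_state_diagonal:
  assumes dense: "closure (range \<iota>) = UNIV" and st: "state \<phi>"
    and val: "\<And>r k s. \<phi> (\<iota> (pol_monomial r k s)) = (if k = 0 \<and> P r s then 1 else 0)"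
  shows "idempotent_state t \<Delta> \<phi>"
  unfolding idempotent_state_iff[OF dense st]
proof (intro allI)
  fix r k s
  show "\<phi> (\<iota> (pol_monomial r (int k) s)) =
      (\<Sum>i\<le>k. \<phi> (\<iota> (pol_monomial (r + i) (int (k - i)) s)) * \<phi> (\<iota> (pol_monomial r (int i) (k - i + s))))"
  proof (cases "k = 0")
    case False
    then show ?thesis
      by (subst sum.neutral) (auto simp: val)
  qed (auto simp: val)
qed

end

section \<open>Classification\<close>

context
  fixes f :: "pol \<Rightarrow> complex"
  assumes pos: "positive_functional f" and one: "f 1 = 1"
    and idem: "\<And>r k s. f (pol_monomial r (int k) s) =
      (\<Sum>i\<le>k. f (pol_monomial (r + i) (int (k - i)) s) * f (pol_monomial r (int i) (k - i + s)))"
begin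

definition alpha_moment :: "nat \<Rightarrow> nat \<Rightarrow> complex"
  where "alpha_moment r s = f (star pol_alpha ^ r * pol_alpha ^ s)"

lemma f_monomial_0: "f (pol_monomial r 0 s) = alpha_moment r s"
  by (simp add: alpha_moment_def pol_monomial_def)

lemma alpha_moment_01: "alpha_moment r s = 0 \<or> alpha_moment r s = 1"
  using idem[of r 0 s] by (simp add: f_monomial_0)

lemma alpha_moment_00: "alpha_moment 0 0 = 1"
  by (simp add: alpha_moment_def one)

lemma alpha_moment_cnj: "alpha_moment s r = cnj (alpha_moment r s)"
  using positive_functional_star[OF pos, of "star pol_alpha ^ r * pol_alpha ^ s"]
  by (simp add: alpha_moment_def star_mult star_power star_star)

lemma alpha_moment_sym: "alpha_moment s r = alpha_moment r s"
  using alpha_moment_cnj[of s r] alpha_moment_01[of r s] by auto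

text \<open>By Cauchy-Schwarz the product of the two diagonal values is at least 1, and each of them
  is 0 or 1.\<close>

lemma alpha_moment_diag: "alpha_moment r s = 1 \<Longrightarrow> alpha_moment r r = 1 \<and> alpha_moment s s = 1"
  using positive_functional_cauchy_schwarz[OF pos, of "pol_alpha ^ r" "pol_alpha ^ s"]
    alpha_moment_01[of r r] alpha_moment_01[of s s]
  by (auto simp: alpha_moment_def star_power)

text \<open>Inserting \<gamma>*\<gamma> = 1 - \<alpha>*\<alpha> telescopes. For r = s the left side
  is the squared GNS norm of \<gamma>\<alpha>^s, so the diagonal values decrease, and equality of
  neighbours yields a null vector.\<close>

lemma alpha_moment_diff: "f (star pol_alpha ^ r * star pol_gamma * (pol_gamma * pol_alpha ^ s)) = alpha_moment r s - alpha_moment (Suc r) (Suc s)"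
proof -
  have "star pol_alpha ^ r * star pol_gamma * (pol_gamma * pol_alpha ^ s) =
      star pol_alpha ^ r * (star pol_gamma * pol_gamma) * pol_alpha ^ s"
    by (simp add: mult.assoc)
  also have "\<dots> = star pol_alpha ^ r * pol_alpha ^ s - star pol_alpha ^ Suc r * pol_alpha ^ Suc s"
    unfolding pol_star_relations(4) power_Suc2[of "star pol_alpha"] power_Suc[of pol_alpha]
    by (simp add: left_diff_distrib right_diff_distrib mult.assoc)
  finally show ?thesis
    by (simp add: alpha_moment_def clinear_diff[OF positive_functionalD(1)[OF pos]])
qed

lemma alpha_moment_diag_antimono: "m \<le> n \<Longrightarrow> alpha_moment n n = 1 \<Longrightarrow> alpha_moment m m = 1"
proof (induction rule: inc_induct)
  case (step k)
  have "0 \<le> Re (alpha_moment k k - alpha_moment (Suc k) (Suc k))"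
    using positive_functionalD(2)[OF pos, of "pol_gamma * pol_alpha ^ k"]
    by (simp add: alpha_moment_diff[symmetric] star_mult star_power)
  then show ?case
    using step alpha_moment_01[of k k] by auto
qed

text \<open>By \<open>alpha_moment_diff\<close> the assumption says that \<gamma>\<alpha>^s is a
  null vector. Since \<gamma> is normal, so is \<gamma>*\<alpha>^s, which gives the third
  claim.\<close>

lemma gamma_null:
  assumes "alpha_moment s s = alpha_moment (Suc s) (Suc s)"
  shows "f (x * (pol_gamma * pol_alpha ^ s)) = 0" "f (star pol_alpha ^ s * star pol_gamma * x) = 0"
    "f (star pol_alpha ^ s * pol_gamma * x) = 0"
proof -
  have null: "f (star (pol_gamma * pol_alpha ^ s) * (pol_gamma * pol_alpha ^ s)) = 0"
    using alpha_moment_diff[of s s] assms by (simp add: star_mult star_power)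
  show "f (x * (pol_gamma * pol_alpha ^ s)) = 0"
    using positive_functional_null(1)[OF pos null] .
  show "f (star pol_alpha ^ s * star pol_gamma * x) = 0"
    using positive_functional_null(2)[OF pos null, of x] by (simp add: star_mult star_power)
  have "star (star pol_gamma * pol_alpha ^ s) * (star pol_gamma * pol_alpha ^ s) =
      star (pol_gamma * pol_alpha ^ s) * (pol_gamma * pol_alpha ^ s)"
  proof -
    have "star (star pol_gamma * pol_alpha ^ s) * (star pol_gamma * pol_alpha ^ s) =
        star (pol_alpha ^ s) * (pol_gamma * star pol_gamma) * pol_alpha ^ s"
      by (simp add: star_mult star_star mult.assoc)
    then show ?thesis
      by (simp add: pol_relations(3) star_mult mult.assoc)
  qed
  with null have "f (star (star pol_gamma * pol_alpha ^ s) * (star pol_gamma * pol_alpha ^ s)) = 0"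
    by simp
  from positive_functional_null(2)[OF pos this, of x]
  show "f (star pol_alpha ^ s * pol_gamma * x) = 0"
    by (simp add: star_mult star_star star_power)
qed

text \<open>
  In the recursion for a monomial with \<open>k > 0\<close> only the two extreme terms survive, and their
  coefficients are 0 unless positivity already forces the monomial to vanish.
\<close>

lemma f_monomial_pos: "f (pol_monomial r (int (Suc k)) s) = 0"
proof (induction k arbitrary: r s rule: less_induct)
  case (less k)
  \<comment> \<open>A diagonal value 1 at n forces the value 1 at all smaller indices, in particular
    at the neighbours m and m + 1.\<close>
  have mono: "alpha_moment m m = alpha_moment (Suc m) (Suc m)" if "alpha_moment n n = 1" "m < n" for m n
    using alpha_moment_diag_antimono[of "Suc m" n] alpha_moment_diag_antimono[of m n] that by simp
  let ?h = "\<lambda>i. f (pol_monomial (r + i) (int (Suc k - i)) s) * f (pol_monomial r (int i) (Suc k - i + s))"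
  have "f (pol_monomial r (int (Suc k)) s) = (\<Sum>i\<le>Suc k. ?h i)"
    by (rule idem)
  also have "\<dots> = ?h 0 + (\<Sum>i<k. ?h (Suc i)) + ?h (Suc k)"
    by (subst sum.atMost_Suc, subst lessThan_Suc_atMost[symmetric], subst sum.lessThan_Suc_shift)
       (rule HOL.refl)
  \<comment> \<open>The second factor of \<open>?h (Suc i)\<close> has \<gamma>-exponent
    \<open>Suc i\<close> with i < k, so the induction hypothesis applies to it.\<close>
  also have "(\<Sum>i<k. ?h (Suc i)) = 0"
    using less by (intro sum.neutral) auto
  finally have eq: "f (pol_monomial r (int (Suc k)) s) =
      f (pol_monomial r (int (Suc k)) s) * alpha_moment r (Suc k + s) + alpha_moment (r + Suc k) s * f (pol_monomial r (int (Suc k)) s)"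
    by (simp add: f_monomial_0 del: of_nat_Suc)
  consider "alpha_moment r (Suc k + s) = 1" | "alpha_moment (r + Suc k) s = 1" | "alpha_moment r (Suc k + s) = 0" "alpha_moment (r + Suc k) s = 0"
    using alpha_moment_01 by metis
  then show ?case
  \<comment> \<open>A coefficient 1 gives a diagonal value 1 strictly above s or r, respectively.
    Hence \<gamma>\<alpha>^s or \<gamma>*\<alpha>^r is a null vector; the monomial ends in the
    former or begins with the adjoint of the latter.\<close>
  proof cases
    case 1
    then have "alpha_moment s s = alpha_moment (Suc s) (Suc s)"
      using alpha_moment_diag[of r "Suc k + s"] mono[of "Suc k + s" s] by simp
    then show ?thesis
      using gamma_null(1)[of s "star pol_alpha ^ r * pol_gamma ^ k"]
      unfolding pol_monomial_def pol_gamma_powi_nat power_Suc2 by (simp add: mult.assoc)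
  next
    case 2
    then have "alpha_moment r r = alpha_moment (Suc r) (Suc r)"
      using alpha_moment_diag[of "r + Suc k" s] mono[of "r + Suc k" r] by simp
    then show ?thesis
      using gamma_null(3)[of r "pol_gamma ^ k * pol_alpha ^ s"]
      unfolding pol_monomial_def pol_gamma_powi_nat power_Suc by (simp add: mult.assoc)
  next
    case 3
    then show ?thesis using eq by simp
  qed
qed

lemma f_monomial: "f (pol_monomial r k s) = (if k = 0 then alpha_moment r s else 0)"
proof -
  have pos0: "f (pol_monomial r k s) = 0" if "k > 0" for r k s
  proof -
    have "k = int (Suc (nat (k - 1)))"
      using that by simp
    then show ?thesis
      using f_monomial_pos[of r "nat (k - 1)" s] by (rule ssubst)
  qed
  have "f (pol_monomial r k s) = 0" if "k < 0"
    using pos0[of "- k" s r] that positive_functional_star[OF pos, of "pol_monomial s (- k) r"]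
    by (simp add: star_pol_monomial)
  then show ?thesis
    using pos0[of k r s] f_monomial_0[of r s] by (cases k "0 :: int" rule: linorder_cases) auto
qed

text \<open>The null vector \<gamma>\<alpha>^s makes the difference in
  \<open>alpha_moment_diff\<close> vanish for every r.\<close>

lemma alpha_moment_shift: "alpha_moment s s = alpha_moment (Suc s) (Suc s) \<Longrightarrow> alpha_moment (Suc r) (Suc s) = alpha_moment r s"
  using gamma_null(1)[of s "star pol_alpha ^ r * star pol_gamma"] alpha_moment_diff[of r s] by simp

text \<open>\<alpha>^d - 1 is a null vector: its squared norm is 1 - 1 - 1 + 1. Thus \<alpha>^d
  fixes the cyclic vector.\<close>

lemma f_mult_alpha_power:
  assumes "alpha_moment 0 d = 1"
  shows "f (x * pol_alpha ^ d) = f x"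
proof -
  have "f (star (pol_alpha ^ d - 1) * (pol_alpha ^ d - 1)) = alpha_moment d d - alpha_moment 0 d - alpha_moment d 0 + 1"
    by (simp add: alpha_moment_def star_diff star_power left_diff_distrib right_diff_distrib clinear_simps positive_functionalD(1)[OF pos] one)
  also have "\<dots> = 0"
    using assms alpha_moment_sym[of d 0] alpha_moment_diag[of 0 d] by simp
  finally have "f (x * (pol_alpha ^ d - 1)) = 0"
    by (rule positive_functional_null(1)[OF pos])
  then show ?thesis
    by (simp add: right_diff_distrib clinear_simps positive_functionalD(1)[OF pos])
qed

lemma alpha_moment_add_mult: "alpha_moment 0 d = 1 \<Longrightarrow> alpha_moment 0 (e + q * d) = alpha_moment 0 e"
proof (induction q)
  case (Suc q)
  have "alpha_moment 0 (e + Suc q * d) = f (pol_alpha ^ (e + q * d) * pol_alpha ^ d)"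
    by (simp add: alpha_moment_def add_ac flip: power_add)
  then show ?case
    using Suc f_mult_alpha_power[OF Suc.prems] by (simp add: alpha_moment_def)
qed simp

text \<open>As the diagonal never drops, \<open>alpha_moment_shift\<close> applies everywhere and
  leaves only the dependence on s - r. The differences with value 1 are then the multiples of a
  single m.\<close>

lemma classification_periodic:
  assumes all: "\<And>m. alpha_moment m m = 1"
  shows "\<exists>m. \<forall>r s. alpha_moment r s = (if r mod m = s mod m then 1 else 0)"
proof -
  have diag: "alpha_moment r (r + d) = alpha_moment 0 d" for r d
    by (induction r) (simp_all add: alpha_moment_shift all)
  have "\<exists>m. \<forall>d. alpha_moment 0 d = 1 \<longleftrightarrow> m dvd d"
  proof (cases "\<exists>d>0. alpha_moment 0 d = 1")
    case False
    then have "alpha_moment 0 d \<noteq> 1" if "d > 0" for d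
      using that by blast
    \<comment> \<open>Only 0 is divisible by 0, so the absence of a positive period is encoded by m
      = 0.\<close>
    then have "alpha_moment 0 d = 1 \<longleftrightarrow> 0 dvd d" for d
      using alpha_moment_00 by (cases "d = 0") simp_all
    then show ?thesis by blast
  next
    case True
    \<comment> \<open>The least positive period; a nonzero remainder modulo m with value 1 would
      contradict minimality.\<close>
    define m where "m = (LEAST d. d > 0 \<and> alpha_moment 0 d = 1)"
    have m: "m > 0" "alpha_moment 0 m = 1"
      using LeastI_ex[OF True[unfolded Bex_def]] by (auto simp: m_def)
    have least: "e = 0" if "alpha_moment 0 e = 1" "e < m" for e
      using not_less_Least[of e "\<lambda>d. d > 0 \<and> alpha_moment 0 d = 1"] that by (auto simp: m_def)
    have "alpha_moment 0 d = 1 \<longleftrightarrow> m dvd d" for d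
    proof -
      have "alpha_moment 0 d = alpha_moment 0 (d mod m)"
        using alpha_moment_add_mult[OF m(2), of "d mod m" "d div m"] by simp
      moreover have "alpha_moment 0 (d mod m) = 1 \<longleftrightarrow> d mod m = 0"
        using least[of "d mod m"] m(1) alpha_moment_00 by (cases "d mod m = 0") auto
      ultimately show ?thesis
        by (simp only: dvd_eq_mod_eq_0)
    qed
    then show ?thesis by blast
  qed
  then obtain m where m: "\<And>d. alpha_moment 0 d = 1 \<longleftrightarrow> m dvd d" by blast
  have le: "alpha_moment r s = 1 \<longleftrightarrow> r mod m = s mod m" if "r \<le> s" for r s
    using diag[of r "s - r"] m[of "s - r"] mod_eq_dvd_iff_nat[OF that, of m] that by auto
  have "alpha_moment r s = 1 \<longleftrightarrow> r mod m = s mod m" for r s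
    using le[of r s] le[of s r] alpha_moment_sym[of r s] by (metis nat_le_linear)
  then show ?thesis
    using alpha_moment_01 by (metis (full_types))
qed

lemma classification_truncated:
  assumes "alpha_moment m m \<noteq> 1"
  shows "\<exists>n. \<forall>r s. alpha_moment r s = (if r = s \<and> r \<le> n then 1 else 0)"
proof -
  define N where "N = (LEAST m. alpha_moment m m \<noteq> 1)"
  have N: "alpha_moment N N \<noteq> 1"
    unfolding N_def using assms by (rule LeastI)
  have N': "alpha_moment k k = 1" if "k < N" for k
    using not_less_Least[OF that[unfolded N_def]] by simp
  have "N \<noteq> 0"
    using N alpha_moment_00 by (intro notI) simp
  then obtain n where n: "N = Suc n"
    using not0_implies_Suc by blast
  have p: "alpha_moment k k = 1 \<longleftrightarrow> k \<le> n" for k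
    using N N'[of k] n alpha_moment_diag_antimono[of N k] by (cases "k \<le> n") auto
  have lt: "alpha_moment r s \<noteq> 1" if "r < s" for r s
  proof
    assume 1: "alpha_moment r s = 1"
    define d where "d = s - r"
    have s: "s \<le> n"
      using alpha_moment_diag[OF 1] p by simp
    \<comment> \<open>As long as the second index stays below n, the neighbouring diagonal values
      are both 1 and a shift along the diagonal is allowed. This transports the value 1 from (r, s)
      to (0, d).\<close>
    have "alpha_moment i (i + d) = alpha_moment 0 d" if "i + d \<le> n" for i
      using that
    proof (induction i)
      case (Suc i)
      then have "alpha_moment (i + d) (i + d) = alpha_moment (Suc (i + d)) (Suc (i + d))"
        using p[of "i + d"] p[of "Suc (i + d)"] by simp
      then show ?case
        using alpha_moment_shift[of "i + d" i] Suc by simp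
    qed simp
    from this[of r] have d: "alpha_moment 0 d = 1" "d > 0"
      using that s 1 by (simp_all add: d_def)
    \<comment> \<open>Multiples of d inherit the value 1, and for d > 0 the multiple (n + 1) d
      exceeds n, beyond which the diagonal values are 0.\<close>
    have "alpha_moment 0 (Suc n * d) = 1"
      using alpha_moment_add_mult[OF d(1), of 0 "Suc n"] alpha_moment_00 by simp
    then have "Suc n * d \<le> n"
      using alpha_moment_diag p by blast
    then show False
      using d(2) by (cases d) auto
  qed
  have "alpha_moment r s = 1 \<longleftrightarrow> r = s \<and> r \<le> n" for r s
    using lt[of r s] lt[of s r] p[of r] alpha_moment_sym[of r s] by (cases r s rule: linorder_cases) auto
  then show ?thesis
    using alpha_moment_01 by (metis (full_types))
qed

lemma classification:
  "(\<exists>m. \<forall>r k s. f (pol_monomial r k s) = (if k = 0 \<and> r mod m = s mod m then 1 else 0)) \<or>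
    (\<exists>n. \<forall>r k s. f (pol_monomial r k s) = (if k = 0 \<and> r = s \<and> r \<le> n then 1 else 0))"
proof (cases "\<forall>m. alpha_moment m m = 1")
  case True
  then obtain m where "\<forall>r s. alpha_moment r s = (if r mod m = s mod m then 1 else 0)"
    using classification_periodic by blast
  then have "\<forall>r k s. f (pol_monomial r k s) = (if k = 0 \<and> r mod m = s mod m then 1 else 0)"
    by (simp add: f_monomial)
  then show ?thesis by blast
next
  case False
  then obtain n where "\<forall>r s. alpha_moment r s = (if r = s \<and> r \<le> n then 1 else 0)"
    using classification_truncated by blast
  then have "\<forall>r k s. f (pol_monomial r k s) = (if k = 0 \<and> r = s \<and> r \<le> n then 1 else 0)"
    by (simp add: f_monomial)
  then show ?thesis by blast
qed

end

section \<open>The states \<psi>_n on C(SU_0(2))\<close>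

lemma norm_star: "norm (star x) = norm (x :: 'a::cstar_algebra)"
proof -
  have le: "norm x \<le> norm (star x)" for x :: 'a
  proof (cases "x = 0")
    case False
    have "norm x * norm x \<le> norm (star x) * norm x"
      using cstar_identity[of x] norm_mult_ineq[of "star x" x] by (simp add: power2_eq_square)
    then show ?thesis using False by simp
  qed simp
  show ?thesis
    using le[of x] le[of "star x"] by (simp add: star_star)
qed

lemma continuous_on_star: "continuous_on UNIV (star :: 'a::cstar_algebra \<Rightarrow> 'a)"
proof -
  have "bounded_linear (star :: 'a \<Rightarrow> 'a)"
    by (rule bounded_linear_intro[of _ 1])
       (simp_all add: star_add scaleR_scaleC[where 'a = 'a] star_scaleC norm_star)
  then show ?thesis by (rule linear_continuous_on)
qed

lemma enveloping_cstarD: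
  assumes "enveloping_cstar \<iota>"
  shows "star_hom \<iota>" "closure (range \<iota>) = UNIV"
  using assms by (auto simp: enveloping_cstar_def)

lemma eq_on_monomials:
  fixes \<iota> :: "pol \<Rightarrow> 'a::cstar_algebra" and \<phi> \<psi> :: "'a \<Rightarrow> complex"
  assumes "enveloping_cstar \<iota>" "clinear \<phi>" "continuous_on UNIV \<phi>" "clinear \<psi>" "continuous_on UNIV \<psi>"
    and "\<And>r k s. \<phi> (\<iota> (pol_monomial r k s)) = \<psi> (\<iota> (pol_monomial r k s))"
  shows "\<phi> = \<psi>"
  using assms(3,5) enveloping_cstarD(2)[OF assms(1)]
proof (rule continuous_eq_of_dense)
  note lin = star_homD(1)[OF enveloping_cstarD(1)[OF assms(1)]]
  show "\<phi> (\<iota> x) = \<psi> (\<iota> x)" for x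
    using clinear_eq_on_monomials[OF clinear_comp[OF assms(2) lin] clinear_comp[OF assms(4) lin] assms(6)] .
qed

text \<open>Existence extends \<open>pol_psi n\<close> from the dense image of \<open>pol\<close>,
  by the estimate against the enveloping norm; uniqueness holds because monomials span a dense
  subspace.\<close>

lemma is_su0_psi_ex1:
  assumes "enveloping_cstar \<iota>"
  shows "\<exists>!\<psi>. is_su0_psi \<iota> n \<psi>"
proof (rule ex_ex1I)
  note hom = star_homD[OF enveloping_cstarD(1)[OF assms]]
  note pos = positive_functional_pol_psi[of n]
  have "pol_psi n 1 = 1"
    by (simp add: pol_psi_def pol_action_simps)
  then have bound: "cmod (pol_psi n x) \<le> norm (\<iota> x)" for x
    by (rule positive_functional_le_cstar_norm[OF pos gns_seminorm_pol_bounded[OF pos] assms])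
  have "\<exists>F. clinear F \<and> continuous_on UNIV F \<and> (\<forall>x. F (\<iota> x) = pol_psi n x)"
  proof (rule clinear_extension[OF enveloping_cstarD(2)[OF assms]])
    show "\<exists>z. \<iota> z = \<iota> x + \<iota> y \<and> pol_psi n z = pol_psi n x + pol_psi n y" for x y
      using clinear_add[OF hom(1)] clinear_add[OF positive_functionalD(1)[OF pos]] by blast
    show "\<exists>z. \<iota> z = c *\<^sub>C \<iota> x \<and> pol_psi n z = c * pol_psi n x" for c x
      using clinear_scaleC[OF hom(1)] clinear_scaleC[OF positive_functionalD(1)[OF pos]]
      unfolding scaleC_complex_def by blast
  qed (rule bound)
  then show "\<exists>\<psi>. is_su0_psi \<iota> n \<psi>"
    unfolding is_su0_psi_def by (metis pol_psi_monomial)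
next
  fix \<psi> \<psi>' assume "is_su0_psi \<iota> n \<psi>" "is_su0_psi \<iota> n \<psi>'"
  then show "\<psi> = \<psi>'"
    by (intro eq_on_monomials[OF assms]) (simp_all add: is_su0_psi_def)
qed

lemma is_su0_psi_su0_psi: "enveloping_cstar \<iota> \<Longrightarrow> is_su0_psi \<iota> n (su0_psi \<iota> n)"
  unfolding su0_psi_def by (rule theI'[OF is_su0_psi_ex1])

text \<open>Positivity is inherited from \<open>pol_psi n\<close> on the image of \<iota> and passes
  to the closure, since \<open>star\<close> and \<psi>_n are continuous and the nonnegative reals
  are closed.\<close>

lemma state_su0_psi:
  fixes \<iota> :: "pol \<Rightarrow> 'a::cstar_algebra"
  assumes "enveloping_cstar \<iota>"
  shows "state (su0_psi \<iota> n)"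
proof -
  let ?\<psi> = "su0_psi \<iota> n"
  note hom = star_homD[OF enveloping_cstarD(1)[OF assms]]
  have \<psi>: "clinear ?\<psi>" "continuous_on UNIV ?\<psi>"
      "\<And>r k s. ?\<psi> (\<iota> (pol_monomial r k s)) = (if k = 0 \<and> r = s \<and> r \<le> n then 1 else 0)"
    using is_su0_psi_su0_psi[OF assms] by (auto simp: is_su0_psi_def)
  have eq: "?\<psi> (\<iota> x) = pol_psi n x" for x
    by (rule clinear_eq_on_monomials[OF clinear_comp[OF \<psi>(1) hom(1)]
          positive_functionalD(1)[OF positive_functional_pol_psi]])
       (simp add: \<psi>(3) pol_psi_monomial)
  have "continuous_on UNIV (\<lambda>x. ?\<psi> (star x * x))"
    by (rule continuous_on_compose2[OF \<psi>(2)]) (auto intro!: continuous_intros continuous_on_star)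
  then have "closed ((\<lambda>x. ?\<psi> (star x * x)) -` \<real>\<^sub>\<ge>\<^sub>0)"
    by (rule closed_vimage[OF closed_nonneg_Reals_complex])
  moreover have "range \<iota> \<subseteq> (\<lambda>x. ?\<psi> (star x * x)) -` \<real>\<^sub>\<ge>\<^sub>0"
    using positive_functional_pol_psi[of n]
    by (auto simp: positive_functional_def hom(3,4)[symmetric] eq)
  ultimately have "UNIV \<subseteq> (\<lambda>x. ?\<psi> (star x * x)) -` \<real>\<^sub>\<ge>\<^sub>0"
    using enveloping_cstarD(2)[OF assms] closure_minimal by metis
  moreover have "?\<psi> 1 = 1"
    using eq[of 1] by (simp add: hom(2) pol_psi_def pol_action_simps)
  ultimately show ?thesis
    using \<psi>(1,2) by (auto simp: state_def)
qed

theorem theorem6p5: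
  fixes \<iota> :: "pol \<Rightarrow> 'a::cstar_algebra"
    and t :: "'a \<Rightarrow> 'a \<Rightarrow> 'b::cstar_algebra"
    and \<Delta> :: "'a \<Rightarrow> 'b"
    and \<epsilon> :: "'a \<Rightarrow> complex"
    and j :: "'a \<Rightarrow> complex \<Rightarrow> complex"
  assumes "enveloping_cstar \<iota>"
    and "spatial_tensor t"
    and "su0_coproduct \<iota> t \<Delta>"
    and "su0_counit \<iota> \<epsilon>"
    and "su0_to_circle \<iota> j"
  shows "(\<forall>n. \<exists>!\<psi>. is_su0_psi \<iota> n \<psi>) \<and>
    {\<phi>. idempotent_state t \<Delta> \<phi>} = su0_phi \<epsilon> j ` {1..} \<union> range (su0_psi \<iota>)"
proof (rule conjI)
  show "\<forall>n. \<exists>!\<psi>. is_su0_psi \<iota> n \<psi>"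
    using is_su0_psi_ex1[OF assms(1)] by blast
next
  note \<iota> = enveloping_cstarD(1)[OF assms(1)] and dense = enveloping_cstarD(2)[OF assms(1)]
  \<comment> \<open>Parametrizes the extended indices by naturals, with 0 in the place of
    \<infinity>, to match the modulus in \<open>classification\<close>.\<close>
  define index where "index m = (if m = 0 then \<infinity> else enat m)" for m
  note phi = su0_phi[OF \<iota> assms(4,5), folded index_def]
  have psi: "clinear (su0_psi \<iota> n)" "continuous_on UNIV (su0_psi \<iota> n)"
    "su0_psi \<iota> n (\<iota> (pol_monomial r k s)) = (if k = 0 \<and> r = s \<and> r \<le> n then 1 else 0)" for n r k s
    using is_su0_psi_su0_psi[OF assms(1), of n] by (auto simp: is_su0_psi_def)
  have index: "{1..} = range index"
  proof (rule set_eqI)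
    show "n \<in> {1..} \<longleftrightarrow> n \<in> range index" for n
      by (cases n) (auto simp: index_def image_iff one_enat_def split: if_splits intro: exI[of _ 0])
  qed
  show "{\<phi>. idempotent_state t \<Delta> \<phi>} = su0_phi \<epsilon> j ` {1..} \<union> range (su0_psi \<iota>)"
  proof (intro equalityI subsetI)
    fix \<phi> assume "\<phi> \<in> {\<phi>. idempotent_state t \<Delta> \<phi>}"
    then have idem: "idempotent_state t \<Delta> \<phi>" and st: "state \<phi>"
      by (auto simp: idempotent_state_def)
    have lin: "clinear \<phi>" "continuous_on UNIV \<phi>"
      using st by (auto simp: state_def)
    have "positive_functional (\<lambda>x. \<phi> (\<iota> x))"
      using st clinear_comp[OF lin(1) star_homD(1)[OF \<iota>]]
      by (simp add: positive_functional_def state_def star_homD[OF \<iota>])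
    moreover have "\<phi> (\<iota> 1) = 1"
      using st by (simp add: state_def star_homD[OF \<iota>])
    ultimately consider m where "\<And>r k s. \<phi> (\<iota> (pol_monomial r k s)) = (if k = 0 \<and> r mod m = s mod m then 1 else 0)"
      | n where "\<And>r k s. \<phi> (\<iota> (pol_monomial r k s)) = (if k = 0 \<and> r = s \<and> r \<le> n then 1 else 0)"
      using classification[of "\<lambda>x. \<phi> (\<iota> x)"]
        idem[unfolded idempotent_state_iff[OF \<iota> assms(2,3) dense st]] by blast
    then show "\<phi> \<in> su0_phi \<epsilon> j ` {1..} \<union> range (su0_psi \<iota>)"
    proof cases
      case (1 m)
      have "\<phi> = su0_phi \<epsilon> j (index m)"
        using phi(1)[of m] by (intro eq_on_monomials[OF assms(1) lin]) (simp_all add: state_def 1 phi(2))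
      then show ?thesis
        unfolding index by blast
    next
      case (2 n)
      have "\<phi> = su0_psi \<iota> n"
        by (intro eq_on_monomials[OF assms(1) lin] psi(1,2)) (simp add: 2 psi(3))
      then show ?thesis by blast
    qed
  next
    fix \<phi> assume "\<phi> \<in> su0_phi \<epsilon> j ` {1..} \<union> range (su0_psi \<iota>)"
    then consider m where "\<phi> = su0_phi \<epsilon> j (index m)" | n where "\<phi> = su0_psi \<iota> n"
      unfolding index by blast
    then show "\<phi> \<in> {\<phi>. idempotent_state t \<Delta> \<phi>}"
    proof cases
      case (1 m)
      show ?thesis
        using idempotent_state_diagonal[OF \<iota> assms(2,3) dense phi(1)[of m] phi(2)[of m]] 1 by simp
    next
      case (2 n)
      show ?thesis
        using idempotent_state_diagonal[OF \<iota> assms(2,3) dense state_su0_psi[OF assms(1), of n] psi(3)[of n]] 2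
        by simp
    qed
  qed
qed

end
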